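(* Let $G$ be a finite $2$-group such that $G/G'$ is of type $(2,4)$, and let $M$ be the maximal subgroup of $G$ such that $M/G'$ is of type $(2,2)$. Then $M/M'$ is of type $(2,2,2)$ or of type $(2,2^m)$ for some $m\geq 1$. More precisely, the following properties are equivalent: 1. $G$ is metacyclic; 2. $M/M'$ is of type $(2,2^m)$ with $m\geq 1$; 3. $d(M)=2$.
   Context: For a group $X$, $X'=[X,X]$ denotes its commutator subgroup and $d(X)$ the minimal number of generators of $X$. A finite abelian group is of type $(n_1,\dots,n_r)$ if it is isomorphic to $\mathbb{Z}/n_1\mathbb{Z}\times\cdots\times\mathbb{Z}/n_r\mathbb{Z}$. A group is metacyclic if it has a cyclic normal subgroup with cyclic quotient. *)

theory Defs
  imports "HOL-Algebra.Algebra"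
begin

abbreviation abelianization :: "('a, 'b) monoid_scheme \<Rightarrow> 'a set monoid"
  where "abelianization K \<equiv> K Mod derived K (carrier K)"

(* "integer_mod_group 0" is the infinite cyclic group, so finiteness is not redundant here. *)
definition has_abelian_type :: "('a, 'b) monoid_scheme \<Rightarrow> nat list \<Rightarrow> bool"
  where "has_abelian_type A ns \<longleftrightarrow>
    comm_group A \<and> finite (carrier A) \<and>
    A \<cong> product_group {..<length ns} (\<lambda>i. integer_mod_group (ns ! i))"

(* Meaningful only for finitely generated K. *)
definition min_generators :: "('a, 'b) monoid_scheme \<Rightarrow> nat"
  where "min_generators K =
    (LEAST n. \<exists>S. S \<subseteq> carrier K \<and> finite S \<and> card S = n \<and> generate K S = carrier K)"

definition metacyclic :: "('a, 'b) monoid_scheme \<Rightarrow> bool"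
  where "metacyclic K \<longleftrightarrow>
    (\<exists>N. N \<lhd> K \<and> cyclic_group (K\<lparr>carrier := N\<rparr>) \<and> cyclic_group (K Mod N))"

definition maximal_subgroup :: "'a set \<Rightarrow> ('a, 'b) monoid_scheme \<Rightarrow> bool"
  where "maximal_subgroup M K \<longleftrightarrow>
    subgroup M K \<and> M \<noteq> carrier K \<and>
    (\<forall>H. subgroup H K \<longrightarrow> M \<subseteq> H \<longrightarrow> H = M \<or> H = carrier K)"

definition finite_p_group :: "nat \<Rightarrow> ('a, 'b) monoid_scheme \<Rightarrow> bool"
  where "finite_p_group p K \<longleftrightarrow>
    group K \<and> finite (carrier K) \<and> (\<exists>k. order K = p ^ k)"

end

theory Submission
  imports Defs
begin

text \<open>Write \<open>G = \<langle>a, b\<rangle>\<close> with \<open>a\<^sup>2, b\<^sup>4 \<in> G'\<close>, so that \<open>M = \<langle>a, b\<^sup>2, G'\<rangle>\<close>, and let \<open>c = [b, a]\<close>.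
  Modulo \<open>M'\<close> the group \<open>G'\<close> is generated by \<open>c\<close>, and \<open>b\<close> inverts \<open>c\<close>; if \<open>a\<^sup>2 = c\<^sup>r\<close> modulo \<open>M'\<close>,
  conjugating by \<open>b\<close> gives \<open>c\<^bsup>2(r+1)\<^esup> = 1\<close>. Hence \<open>M/M'\<close> is either elementary of order 8, or it is of
  type \<open>(2, 2\<^sup>m)\<close> and \<open>G' \<subseteq> \<langle>x\<rangle>M'\<close> for \<open>x = a\<close> or \<open>x = b\<close>. In the second case \<open>M'\<close> can be replaced by
  smaller and smaller normal subgroups until \<open>G' \<subseteq> \<langle>x\<rangle>\<close>, and \<open>G\<close> is metacyclic. In the first case \<open>M\<close>
  needs three generators, whereas a metacyclic \<open>G\<close> has a 2-generated \<open>M\<close>.\<close>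

section \<open>Chief factors of finite 2-groups\<close>

text \<open>The relation \<open>c^(2(r+1)) = 1\<close> acts through the parity of \<open>r\<close>.
  If \<open>r\<close> is odd, \<open>c\<close> is a power of \<open>a^2\<close> modulo
  \<open>M'\<close>. If \<open>r\<close> is even, \<open>r + 1\<close> is odd, so in a 2-group
  \<open>c\<close> has order at most 2 modulo \<open>M'\<close>. A trivial \<open>c\<close> gives
  type \<open>(2, 2)\<close>; otherwise \<open>b^4\<close> is \<open>1\<close> or \<open>c\<close>,
  which separates the elementary group from type \<open>(2, 4)\<close>. The obstacle is the passage
  from \<open>G' \<subseteq> <x>N\<close>, with \<open>N\<close> inside \<open>M'\<close>, to
  \<open>G' \<subseteq> <x>T\<close> for a smaller \<open>T\<close>. Taking \<open>N/T\<close> to be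
  a chief factor makes it central of exponent 2, so the square of an element \<open>x^k n\<close> of
  \<open>G'\<close> is \<open>x^(2k)\<close> modulo \<open>T\<close>. It therefore suffices to trap
  \<open>M'\<close> among the squares of elements of \<open>G'\<close>. This succeeds because
  \<open>x^k\<close> lies in \<open>G'\<close> only for even \<open>k\<close>: modulo
  \<open>T\<close> a commutator of \<open>g\<close> with \<open>x^k\<close> is then itself the
  square of a commutator.\<close>

lemma (in normal) quotient_hom:
  shows "group_hom G (G Mod H) (\<lambda>x. H #> x)"
    and "(\<lambda>x. H #> x) ` carrier G = carrier (G Mod H)"
    and "\<And>x. x \<in> carrier G \<Longrightarrow> H #> x = \<one>\<^bsub>G Mod H\<^esub> \<longleftrightarrow> x \<in> H"
    and "order (G Mod H) * card H = order G"
proof -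
  show "group_hom G (G Mod H) (\<lambda>x. H #> x)"
    using r_coset_hom_Mod factorgroup_is_group is_group
    by (simp add: group_hom_def group_hom_axioms_def)
  show "(\<lambda>x. H #> x) ` carrier G = carrier (G Mod H)"
    by (simp add: carrier_FactGroup)
  show "H #> x = \<one>\<^bsub>G Mod H\<^esub> \<longleftrightarrow> x \<in> H" if "x \<in> carrier G" for x
    using that coset_join1 coset_join2 is_subgroup by (metis one_FactGroup subset)
  show "order (G Mod H) * card H = order G"
    using lagrange[OF is_subgroup] by (simp add: order_def FactGroup_def)
qed

text \<open>Hides the cosets: afterwards the quotient is merely a group \<open>Q\<close> with a
  surjection \<open>f\<close> of prescribed kernel, and identities are computed with the images
  \<open>f x\<close>.\<close>

lemma (in normal) obtain_quotient_hom:
  obtains Q :: "'a set monoid" and f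
  where "group_hom G Q f" "f ` carrier G = carrier Q"
    "\<And>x. x \<in> carrier G \<Longrightarrow> f x = \<one>\<^bsub>Q\<^esub> \<longleftrightarrow> x \<in> H" "order Q * card H = order G"
  using quotient_hom by (rule that)

lemma (in group) commute_inv:
  assumes "y \<otimes> x = x \<otimes> y" "x \<in> carrier G" "y \<in> carrier G"
  shows "y \<otimes> inv x = inv x \<otimes> y"
proof -
  have "y \<otimes> inv x = inv x \<otimes> (x \<otimes> y) \<otimes> inv x"
    using assms(2,3) by (simp add: m_assoc[symmetric])
  also have "\<dots> = inv x \<otimes> y"
    using assms(2,3) by (simp add: assms(1)[symmetric] m_assoc)
  finally show ?thesis .
qed

lemma (in group) conj_commute:
  assumes "g \<otimes> h = h \<otimes> g" "g \<in> carrier G" "h \<in> carrier G"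
  shows "g \<otimes> h \<otimes> inv g = h"
  unfolding assms(1) using assms(2,3) by (simp add: m_assoc)

section \<open>The center and its intersection with normal subgroups\<close>

definition center :: "('a, 'b) monoid_scheme \<Rightarrow> 'a set"
  where "center G = {z \<in> carrier G. \<forall>g\<in>carrier G. g \<otimes>\<^bsub>G\<^esub> z = z \<otimes>\<^bsub>G\<^esub> g}"

lemma centerI:
  "\<lbrakk>z \<in> carrier G; \<And>g. g \<in> carrier G \<Longrightarrow> g \<otimes>\<^bsub>G\<^esub> z = z \<otimes>\<^bsub>G\<^esub> g\<rbrakk> \<Longrightarrow> z \<in> center G"
  unfolding center_def by blast

lemma center_commute: "\<lbrakk>z \<in> center G; g \<in> carrier G\<rbrakk> \<Longrightarrow> g \<otimes>\<^bsub>G\<^esub> z = z \<otimes>\<^bsub>G\<^esub> g"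
  unfolding center_def by blast

lemma center_subset: "center G \<subseteq> carrier G"
  unfolding center_def by blast

lemma (in group) one_in_center: "\<one> \<in> center G"
  by (rule centerI) simp_all

lemma (in group) center_normal: "center G \<lhd> G"
proof (subst normal_inv_iff, intro conjI ballI)
  note comm = center_commute[where G = G]
  have closed: "x \<in> carrier G" if "x \<in> center G" for x
    using that center_subset[of G] by blast
  show "subgroup (center G) G"
  proof
    fix x y assume x: "x \<in> center G" and y: "y \<in> center G"
    show "x \<otimes> y \<in> center G"
    proof (rule centerI)
      fix g assume g: "g \<in> carrier G"
      have "g \<otimes> (x \<otimes> y) = x \<otimes> g \<otimes> y"
        using closed[OF x] closed[OF y] g by (simp add: m_assoc[symmetric] comm[OF x g])
      also have "\<dots> = x \<otimes> y \<otimes> g"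
        using closed[OF x] closed[OF y] g by (simp add: m_assoc comm[OF y g])
      finally show "g \<otimes> (x \<otimes> y) = x \<otimes> y \<otimes> g" .
    qed (use x y closed in simp)
  next
    fix x assume x: "x \<in> center G"
    show "inv x \<in> center G"
      by (rule centerI) (use commute_inv[OF comm[OF x]] closed[OF x] in simp_all)
  qed (simp_all add: center_subset one_in_center)
next
  fix x h assume x: "x \<in> carrier G" and h: "h \<in> center G"
  have "h \<in> carrier G" using h center_subset[of G] by blast
  then show "x \<otimes> h \<otimes> inv x \<in> center G"
    using conj_commute[OF center_commute[OF h x] x] h by simp
qed

lemma (in group_hom) normal_preimage:
  assumes "K \<lhd> H"
  shows "{x \<in> carrier G. h x \<in> K} \<lhd> G"
proof -
  interpret K: normal K H by fact
  show ?thesis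
  proof (subst G.normal_inv_iff, intro conjI ballI)
    show "subgroup {x \<in> carrier G. h x \<in> K} G"
      by unfold_locales auto
  qed (auto simp: K.inv_op_closed2)
qed

text \<open>The class equation restricted to \<open>W\<close>. Conjugation splits \<open>W\<close>
  into orbits of p-power size, and \<open>p\<close> divides \<open>card W\<close>. Since
  \<open>{\<one>}\<close> is one orbit of size 1, the other orbits cannot all have size divisible by
  \<open>p\<close>; a further orbit of size 1 consists of a central element.\<close>

lemma (in group) center_meets_normal:
  assumes p: "Factorial_Ring.prime p" and ord: "order G = p ^ k" and W: "W \<lhd> G" "W \<noteq> {\<one>}"
  obtains w where "w \<in> W" "w \<noteq> \<one>" "w \<in> center G"
proof -
  have fin: "finite (carrier G)"
    using p ord by (metis order_gt_0_iff_finite prime_gt_0_nat zero_less_power)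
  interpret W: normal W G by fact
  define \<phi> where "\<phi> = (\<lambda>g. \<lambda>h\<in>carrier G. g \<otimes> h \<otimes> inv g)"
  interpret A: group_action G "carrier G" \<phi>
    unfolding \<phi>_def by (rule action_by_conjugation)
  let ?o = "orbit G \<phi>"
  have sub: "?o w \<subseteq> W" if "w \<in> W" for w
    using that W.inv_op_closed2 W.subset by (auto simp: orbit_def \<phi>_def)
  have self: "w \<in> ?o w" if "w \<in> W" for w
    using A.orbit_refl that W.subset by blast
  have UN: "W = \<Union> (?o ` W)"
    using sub self by blast
  have finW: "finite W" using fin W.subset finite_subset by blast
  have "card W = sum card (?o ` W)"
  proof -
    have "card (\<Union> (?o ` W)) = sum card (?o ` W)"
    proof (rule card_Union_disjoint)
      show "pairwise disjnt (?o ` W)"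
        using A.disjoint_union W.subset unfolding pairwise_def disjnt_def orbits_def by blast
      show "finite A" if "A \<in> ?o ` W" for A
        using that sub finW finite_subset by blast
    qed
    with UN show ?thesis by simp
  qed
  moreover have one: "?o \<one> = {\<one>}"
  proof
    show "?o \<one> \<subseteq> {\<one>}" by (auto simp: orbit_def \<phi>_def)
    show "{\<one>} \<subseteq> ?o \<one>" using self[OF W.one_closed] by simp
  qed
  ultimately have cardW: "card W = 1 + sum card (?o ` W - {{\<one>}})"
    using finW by (subst (asm) sum.remove[of _ "{\<one>}"]) force+
  have "p dvd card W"
  proof -
    have "card W dvd p ^ k" using lagrange[OF W.is_subgroup] ord by (metis dvd_triv_right)
    then obtain i where i: "card W = p ^ i" using p divides_primepow_nat by blast
    have "card W \<noteq> 1" using W(2) W.one_closed by (metis card_1_singletonE singletonD)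
    with i show ?thesis by (cases i) auto
  qed
  with cardW p have "\<not> p dvd sum card (?o ` W - {{\<one>}})"
    by (metis dvd_add_left_iff not_prime_unit)
  then obtain A where "A \<in> ?o ` W - {{\<one>}}" "\<not> p dvd card A"
    using dvd_sum[of "?o ` W - {{\<one>}}" p card] by blast
  then obtain w where w: "w \<in> W" "?o w \<noteq> {\<one>}" "\<not> p dvd card (?o w)"
    by blast
  have "card (?o w) * card (stabilizer G \<phi> w) = p ^ k"
    using A.orbit_stabilizer_theorem[of w] w(1) W.subset ord by auto
  then have "card (?o w) dvd p ^ k" by (metis dvd_triv_left)
  then obtain i where "card (?o w) = p ^ i" using p divides_primepow_nat by blast
  with w have "card (?o w) = 1" by (cases i) auto
  then have single: "?o w = {w}" using self[OF w(1)] by (auto simp: card_1_singleton_iff)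
  show thesis
  proof
    show "w \<in> W" by fact
    show "w \<noteq> \<one>" using single w by auto
    have wG: "w \<in> carrier G" using w W.subset by blast
    have "g \<otimes> w = w \<otimes> g" if g: "g \<in> carrier G" for g
    proof -
      have "\<phi> g w \<in> ?o w" using g unfolding orbit_def by blast
      then have "g \<otimes> w \<otimes> inv g = w" using single wG by (simp add: \<phi>_def)
      then have "g \<otimes> w \<otimes> inv g \<otimes> g = w \<otimes> g" by simp
      then show ?thesis using g wG by (simp add: m_assoc)
    qed
    with wG show "w \<in> center G" by (rule centerI)
  qed
qed

text \<open>With \<open>T\<close> as large as possible, \<open>N/T\<close> is a minimal normal
  subgroup of \<open>G/T\<close>. The elements of \<open>N/T\<close> that are central in
  \<open>G/T\<close>, and those with trivial square, both form nontrivial normal subgroups, so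
  minimality makes each of them the whole of \<open>N/T\<close>. The lower bound \<open>R\<close> is
  trivial in the descent and contains \<open>c\<close> in the computation of \<open>G'\<close>
  modulo \<open>M'\<close>.\<close>

lemma (in group) chief_step:
  assumes ord: "order G = 2 ^ k" and R: "R \<lhd> G" and N: "N \<lhd> G" and "R \<subset> N"
  obtains T where "T \<lhd> G" "R \<subseteq> T" "T \<subset> N"
    "\<And>n g. n \<in> N \<Longrightarrow> g \<in> carrier G \<Longrightarrow> g \<otimes> n \<otimes> inv g \<otimes> inv n \<in> T"
    "\<And>n. n \<in> N \<Longrightarrow> n \<otimes> n \<in> T"
proof -
  have fin: "finite (carrier G)"
    using ord by (metis order_gt_0_iff_finite pos2 zero_less_power)
  interpret N: normal N G by fact
  have finN: "finite N" using fin N.subset finite_subset by blast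
  define TT where "TT = {T. T \<lhd> G \<and> R \<subseteq> T \<and> T \<subset> N}"
  have "finite TT" unfolding TT_def using finN by (auto intro: finite_subset[of _ "Pow N"])
  moreover have "R \<in> TT" using assms by (simp add: TT_def)
  ultimately have "Max (card ` TT) \<in> card ` TT" and Max: "\<And>S. S \<in> TT \<Longrightarrow> card S \<le> Max (card ` TT)"
    by (auto intro!: Max_in)
  then obtain T where T: "T \<in> TT" and max: "\<And>S. S \<in> TT \<Longrightarrow> card S \<le> card T"
    by auto
  interpret T: normal T G using T by (simp add: TT_def)
  have only: "F = N" if "F \<lhd> G" "T \<subset> F" "F \<subseteq> N" for F
  proof (rule ccontr)
    assume "F \<noteq> N"
    then have "F \<in> TT" using that T by (auto simp: TT_def)
    moreover have "card T < card F" using that finN by (meson finite_subset psubset_card_mono)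
    ultimately show False using max by force
  qed
  obtain Q :: "'a set monoid" and f where Q: "group_hom G Q f" "f ` carrier G = carrier Q"
    "\<And>x. x \<in> carrier G \<Longrightarrow> f x = \<one>\<^bsub>Q\<^esub> \<longleftrightarrow> x \<in> T" "order Q * card T = order G"
    by (rule T.obtain_quotient_hom) (rule that)
  interpret f: group_hom G Q f by fact
  have fT: "f t = \<one>\<^bsub>Q\<^esub>" if "t \<in> T" for t using that Q(3) T.subset by blast
  have NG: "n \<in> carrier G" if "n \<in> N" for n using that N.subset by blast
  have "order Q dvd 2 ^ k" using Q(4) ord by (metis dvd_triv_left)
  then obtain l where l: "order Q = 2 ^ l"
    using divides_primepow_nat two_is_prime_nat by blast
  \<comment> \<open>\<open>F/T\<close> is the part of \<open>N/T\<close> that is central in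
    \<open>G/T\<close>; it is nontrivial because a nontrivial normal subgroup of a 2-group meets the
    center.\<close>
  define F where "F = {n \<in> carrier G. f n \<in> center Q} \<inter> N"
  have "F \<lhd> G"
    unfolding F_def using f.normal_preimage[OF f.H.center_normal] N by (rule normal_subgroup_intersect)
  moreover have "T \<subseteq> F"
    using T fT T.subset f.H.one_in_center by (auto simp: F_def TT_def)
  moreover have "F \<subseteq> N" by (auto simp: F_def)
  moreover have "T \<noteq> F"
  proof -
    have "f ` N \<lhd> Q"
      using normal.surj_hom_normal_subgroup[OF N Q(1,2)] by simp
    moreover have "f ` N \<noteq> {\<one>\<^bsub>Q\<^esub>}"
    proof
      assume *: "f ` N = {\<one>\<^bsub>Q\<^esub>}"
      have "N \<subseteq> T" using Q(3) NG * by blast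
      then show False using T by (auto simp: TT_def)
    qed
    ultimately obtain w where w: "w \<in> f ` N" "w \<noteq> \<one>\<^bsub>Q\<^esub>"
      "w \<in> center Q"
      by (rule f.H.center_meets_normal[OF two_is_prime_nat l])
    then obtain n where "n \<in> N" "w = f n" by blast
    with w have "n \<in> F" "n \<notin> T" using fT NG by (auto simp: F_def)
    then show ?thesis by blast
  qed
  ultimately have FN: "F = N" using only by blast
  have comm: "f g \<otimes>\<^bsub>Q\<^esub> f n = f n \<otimes>\<^bsub>Q\<^esub> f g" if "n \<in> N" "g \<in> carrier G" for n g
    using FN that f.hom_closed center_commute[of _ Q] unfolding F_def by blast
  \<comment> \<open>Squaring is multiplicative modulo \<open>T\<close> on \<open>N\<close> because
    \<open>N = F\<close> is already known to be central there; this makes \<open>S\<close> a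
    subgroup.\<close>
  define S where "S = {n \<in> N. f n \<otimes>\<^bsub>Q\<^esub> f n = \<one>\<^bsub>Q\<^esub>}"
  have "S \<lhd> G"
  proof (subst normal_inv_iff, intro conjI ballI)
    show "subgroup S G"
    proof
      show "S \<subseteq> carrier G" using N.subset by (auto simp: S_def)
      show "\<one> \<in> S" by (simp add: S_def)
    next
      fix x y assume xy: "x \<in> S" "y \<in> S"
      have c: "f x \<in> carrier Q" "f y \<in> carrier Q" "f y \<otimes>\<^bsub>Q\<^esub> f x = f x \<otimes>\<^bsub>Q\<^esub> f y"
        using xy NG comm by (auto simp: S_def)
      have "(f x \<otimes>\<^bsub>Q\<^esub> f y) \<otimes>\<^bsub>Q\<^esub> (f x \<otimes>\<^bsub>Q\<^esub> f y) = (f x \<otimes>\<^bsub>Q\<^esub> f x) \<otimes>\<^bsub>Q\<^esub> (f y \<otimes>\<^bsub>Q\<^esub> f y)"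
      proof -
        have "f y \<otimes>\<^bsub>Q\<^esub> (f x \<otimes>\<^bsub>Q\<^esub> f y) = f x \<otimes>\<^bsub>Q\<^esub> (f y \<otimes>\<^bsub>Q\<^esub> f y)"
          using c(1,2) by (simp add: f.H.m_assoc[symmetric] c(3))
        then show ?thesis using c(1,2) by (simp add: f.H.m_assoc)
      qed
      moreover have "x \<in> N" "y \<in> N" "f x \<otimes>\<^bsub>Q\<^esub> f x = \<one>\<^bsub>Q\<^esub>" "f y \<otimes>\<^bsub>Q\<^esub> f y = \<one>\<^bsub>Q\<^esub>"
        using xy by (simp_all add: S_def)
      ultimately show "x \<otimes> y \<in> S" by (simp add: S_def)
    next
      fix x assume x: "x \<in> S"
      then have xN: "x \<in> N" and "inv\<^bsub>Q\<^esub> (f x \<otimes>\<^bsub>Q\<^esub> f x) = \<one>\<^bsub>Q\<^esub>" by (simp_all add: S_def)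
      then have "f (inv x) \<otimes>\<^bsub>Q\<^esub> f (inv x) = \<one>\<^bsub>Q\<^esub>"
        using NG[OF xN] by (simp add: f.H.inv_mult_group)
      then show "inv x \<in> S" using xN by (simp add: S_def)
    qed
  next
    fix x h assume x: "x \<in> carrier G" and h: "h \<in> S"
    have hN: "h \<in> N" using h by (auto simp: S_def)
    have "f (x \<otimes> h \<otimes> inv x) = f h"
      using x NG[OF hN] f.H.conj_commute[OF comm[OF hN x]] by simp
    then show "x \<otimes> h \<otimes> inv x \<in> S"
      using x h hN N.inv_op_closed2 by (simp add: S_def)
  qed
  moreover have "T \<subseteq> S"
    using T fT by (auto simp: S_def TT_def)
  moreover have "S \<subseteq> N" by (auto simp: S_def)
  moreover have "T \<noteq> S"
  proof -
    obtain n where n: "n \<in> N" "n \<notin> T" using T by (auto simp: TT_def)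
    have "f n [^]\<^bsub>Q\<^esub> ((2::nat) ^ l) = \<one>\<^bsub>Q\<^esub>"
      using f.H.pow_order_eq_1 l n NG by (metis f.hom_closed)
    then have ex: "\<exists>i. f (n [^] ((2::nat) ^ i)) = \<one>\<^bsub>Q\<^esub>" using n NG f.hom_nat_pow by metis
    \<comment> \<open>Repeated squaring of \<open>n\<close> eventually reaches \<open>T\<close>. The
      last term outside \<open>T\<close> has its square in \<open>T\<close> and shows that
      \<open>S\<close> is larger than \<open>T\<close>.\<close>
    define i where "i = (LEAST i. f (n [^] ((2::nat) ^ i)) = \<one>\<^bsub>Q\<^esub>)"
    have i: "f (n [^] ((2::nat) ^ i)) = \<one>\<^bsub>Q\<^esub>" unfolding i_def by (rule LeastI_ex[OF ex])
    have "i \<noteq> 0"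
    proof
      assume "i = 0" then show False using i n NG Q(3) by simp
    qed
    then obtain i' where i': "i = Suc i'" by (cases i) auto
    let ?m = "n [^] ((2::nat) ^ i')"
    have m: "f ?m \<noteq> \<one>\<^bsub>Q\<^esub>"
      using i' not_less_Least[of i' "\<lambda>i. f (n [^] ((2::nat) ^ i)) = \<one>\<^bsub>Q\<^esub>"] unfolding i_def by simp
    have "?m \<otimes> ?m = n [^] ((2::nat) ^ i)"
      using n NG by (simp add: nat_pow_mult i' mult_2)
    then have "f ?m \<otimes>\<^bsub>Q\<^esub> f ?m = \<one>\<^bsub>Q\<^esub>" using i n NG by (metis f.hom_mult nat_pow_closed)
    moreover have "?m \<in> N"
      using subgroup_int_pow_closed[OF N.is_subgroup n(1), of "int (2 ^ i')"] unfolding int_pow_int .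
    ultimately have "?m \<in> S" "?m \<notin> T" using m fT by (auto simp: S_def)
    then show ?thesis by blast
  qed
  ultimately have SN: "S = N" using only by blast
  show thesis
  proof
    show "T \<lhd> G" "R \<subseteq> T" "T \<subset> N" using T by (auto simp: TT_def)
    show "g \<otimes> n \<otimes> inv g \<otimes> inv n \<in> T" if "n \<in> N" "g \<in> carrier G" for n g
      using that f.H.conj_commute[OF comm[OF that]] NG[OF that(1)]
      by (subst Q(3)[symmetric]) simp_all
    show "n \<otimes> n \<in> T" if "n \<in> N" for n
      using that SN NG[OF that(1)] by (subst Q(3)[symmetric]) (auto simp: S_def)
  qed
qed

section \<open>Types of finite abelian groups\<close>

lemma (in group) int_pow_mod:
  assumes "x \<in> carrier G" "x [^] n = \<one>"
  shows "x [^] (k mod int n) = x [^] k"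
proof -
  have "x [^] (int n * (k div int n)) = \<one>"
    using assms int_pow_pow[OF assms(1), of "int n" "k div int n", symmetric] by (simp add: int_pow_int)
  moreover have "x [^] k = x [^] (int n * (k div int n)) \<otimes> x [^] (k mod int n)"
    using assms(1) by (simp add: int_pow_mult[symmetric])
  ultimately show ?thesis using assms(1) by simp
qed

text \<open>A basis with integer exponents suffices, because the exponent of \<open>g i\<close>
  matters only modulo \<open>ns ! i\<close>. Positive moduli make the residues from 0 to
  \<open>ns ! i - 1\<close> the carrier of each factor; modulus 0 would stand for the infinite
  cyclic group.\<close>

lemma (in comm_group) has_abelian_typeI:
  assumes pos: "\<And>i. i < length ns \<Longrightarrow> ns ! i > 0"
    and g: "\<And>i. i < length ns \<Longrightarrow> g i \<in> carrier G" "\<And>i. i < length ns \<Longrightarrow> g i [^] (ns ! i) = \<one>"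
    and gen: "\<And>x. x \<in> carrier G \<Longrightarrow>
      \<exists>k :: nat \<Rightarrow> int. x = finprod G (\<lambda>i. g i [^] k i) {..<length ns}"
    and indep: "\<And>(k :: nat \<Rightarrow> int) i. finprod G (\<lambda>i. g i [^] k i) {..<length ns} = \<one> \<Longrightarrow>
      i < length ns \<Longrightarrow> int (ns ! i) dvd k i"
    and fin: "finite (carrier G)"
  shows "has_abelian_type G ns"
proof -
  let ?I = "{..<length ns}"
  let ?P = "product_group ?I (\<lambda>i. integer_mod_group (ns ! i))"
  define F where "F k = finprod G (\<lambda>i. g i [^] (k i :: int)) ?I" for k
  have P: "group ?P" by simp
  have F_mod: "F (\<lambda>i\<in>?I. k i mod int (ns ! i)) = F k" for k
    unfolding F_def by (rule finprod_cong') (auto simp: g int_pow_mod)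
  have F_add: "F (\<lambda>i. x i + y i) = F x \<otimes> F y" for x y
  proof -
    have "F (\<lambda>i. x i + y i) = finprod G (\<lambda>i. g i [^] x i \<otimes> g i [^] y i) ?I"
      unfolding F_def by (rule finprod_cong') (auto simp: g int_pow_mult)
    then show ?thesis unfolding F_def by (simp add: g Pi_def)
  qed
  have F_closed: "F x \<in> carrier G" for x
    unfolding F_def by (rule finprod_closed) (auto simp: g)
  have hom: "F \<in> hom ?P G"
  proof (rule homI)
    fix x y
    have "x \<otimes>\<^bsub>?P\<^esub> y = (\<lambda>i\<in>?I. (x i + y i) mod int (ns ! i))" by simp
    then show "F (x \<otimes>\<^bsub>?P\<^esub> y) = F x \<otimes> F y" using F_mod[of "\<lambda>i. x i + y i"] F_add by simp
  qed (rule F_closed)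
  then interpret F: group_hom ?P G F
    using P by (simp add: group_hom_def group_hom_axioms_def is_group)
  have "inj_on F (carrier ?P)"
  proof (unfold F.inj_on_one_iff, intro allI impI)
    fix x assume x: "x \<in> carrier ?P" and one: "F x = \<one>"
    show "x = \<one>\<^bsub>?P\<^esub>"
    proof
      fix i
      show "x i = \<one>\<^bsub>?P\<^esub> i"
      proof (cases "i < length ns")
        case True
        then have "int (ns ! i) dvd x i" "0 \<le> x i" "x i < int (ns ! i)"
          using indep[of x i] one PiE_mem[of x ?I "\<lambda>i. carrier (integer_mod_group (ns ! i))" i] x pos[OF True]
          by (simp_all add: F_def carrier_integer_mod_group)
        then have "x i = 0" using zdvd_imp_le[of "int (ns ! i)" "x i"] by fastforce
        then show ?thesis using True by simp
      next
        case False
        then show ?thesis using x by (auto simp: PiE_iff extensional_def)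
      qed
    qed
  qed
  moreover have "F ` carrier ?P = carrier G"
  proof
    show "carrier G \<subseteq> F ` carrier ?P"
    proof
      fix x assume "x \<in> carrier G"
      then obtain k where "x = F k" using gen unfolding F_def by blast
      then have "x = F (\<lambda>i\<in>?I. k i mod int (ns ! i))" using F_mod by simp
      moreover have "(\<lambda>i\<in>?I. k i mod int (ns ! i)) \<in> carrier ?P"
        using pos by (auto simp: carrier_integer_mod_group)
      ultimately show "x \<in> F ` carrier ?P" by blast
    qed
  qed (use F_closed in blast)
  ultimately have "?P \<cong> G"
    using hom by (auto simp: is_iso_def iso_def bij_betw_def)
  then have "G \<cong> ?P" using P group.iso_sym by blast
  then show ?thesis using fin by (simp add: has_abelian_type_def comm_group_axioms)
qed

lemma (in comm_group) has_abelian_type_two: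
  assumes "u \<in> carrier G" "v \<in> carrier G" "m > 0" "n > 0" "u [^] m = \<one>" "v [^] n = \<one>"
    and gen: "\<And>x. x \<in> carrier G \<Longrightarrow> \<exists>(i::int) (j::int). x = u [^] i \<otimes> v [^] j"
    and indep: "\<And>(i::int) (j::int). u [^] i \<otimes> v [^] j = \<one> \<Longrightarrow> int m dvd i \<and> int n dvd j"
    and fin: "finite (carrier G)"
  shows "has_abelian_type G [m, n]"
proof -
  let ?g = "\<lambda>i::nat. if i = 0 then u else v"
  have prod: "finprod G (\<lambda>i. ?g i [^] (k i :: int)) {..<length [m, n]} = u [^] k 0 \<otimes> v [^] k 1" for k
    using assms(1,2) by (simp add: lessThan_Suc m_comm Pi_def)
  show ?thesis
  proof (rule has_abelian_typeI[of "[m, n]" ?g])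
    show "\<exists>k. x = finprod G (\<lambda>i. ?g i [^] (k i :: int)) {..<length [m, n]}" if "x \<in> carrier G" for x
    proof -
      obtain i j :: int where "x = u [^] i \<otimes> v [^] j" using gen[OF \<open>x \<in> carrier G\<close>] by metis
      then show ?thesis unfolding prod by (intro exI[of _ "\<lambda>l. if l = 0 then i else j"]) simp
    qed
    show "int ([m, n] ! i) dvd k i"
      if "finprod G (\<lambda>i. ?g i [^] (k i :: int)) {..<length [m, n]} = \<one>" "i < length [m, n]" for k i
      using that indep[of "k 0" "k 1"] unfolding prod by (cases i) auto
  qed (use assms(1-6) fin in \<open>auto simp: less_Suc_eq\<close>)
qed

lemma (in comm_group) has_abelian_type_three:
  assumes "u \<in> carrier G" "v \<in> carrier G" "w \<in> carrier G" "l > 0" "m > 0" "n > 0"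
    "u [^] l = \<one>" "v [^] m = \<one>" "w [^] n = \<one>"
    and gen: "\<And>x. x \<in> carrier G \<Longrightarrow> \<exists>(i::int) (j::int) (k::int). x = u [^] i \<otimes> v [^] j \<otimes> w [^] k"
    and indep: "\<And>(i::int) (j::int) (k::int). u [^] i \<otimes> v [^] j \<otimes> w [^] k = \<one> \<Longrightarrow> int l dvd i \<and> int m dvd j \<and> int n dvd k"
    and fin: "finite (carrier G)"
  shows "has_abelian_type G [l, m, n]"
proof -
  let ?g = "\<lambda>i::nat. if i = 0 then u else if i = 1 then v else w"
  have prod: "finprod G (\<lambda>i. ?g i [^] (k i :: int)) {..<length [l, m, n]} = u [^] k 0 \<otimes> v [^] k 1 \<otimes> w [^] k 2" for k
    using assms(1,2,3) by (simp add: lessThan_Suc m_comm Pi_def numeral_2_eq_2)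
  show ?thesis
  proof (rule has_abelian_typeI[of "[l, m, n]" ?g])
    show "\<exists>k. x = finprod G (\<lambda>i. ?g i [^] (k i :: int)) {..<length [l, m, n]}" if "x \<in> carrier G" for x
    proof -
      obtain i j r :: int where "x = u [^] i \<otimes> v [^] j \<otimes> w [^] r" using gen[OF \<open>x \<in> carrier G\<close>] by metis
      then show ?thesis unfolding prod
        by (intro exI[of _ "\<lambda>l. if l = 0 then i else if l = 1 then j else r"]) simp
    qed
    show "int ([l, m, n] ! i) dvd k i"
      if "finprod G (\<lambda>i. ?g i [^] (k i :: int)) {..<length [l, m, n]} = \<one>" "i < length [l, m, n]" for k i
      using that indep[of "k 0" "k 1" "k 2"] unfolding prod by (auto simp: less_Suc_eq numeral_2_eq_2)
  qed (use assms(1-9) fin in \<open>auto simp: less_Suc_eq\<close>)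
qed

text \<open>The basis consists of the preimages of the two unit vectors under an isomorphism with
  the product group. Integer exponents avoid any further mention of residues.\<close>

lemma has_abelian_type_twoE:
  assumes type: "has_abelian_type G [m, n]" and pos: "m > 0" "n > 0"
  obtains u v where "u \<in> carrier G" "v \<in> carrier G"
    "\<And>x. x \<in> carrier G \<Longrightarrow> \<exists>(i::int) (j::int). x = u [^]\<^bsub>G\<^esub> i \<otimes>\<^bsub>G\<^esub> v [^]\<^bsub>G\<^esub> j"
    "\<And>(i::int) (j::int). u [^]\<^bsub>G\<^esub> i \<otimes>\<^bsub>G\<^esub> v [^]\<^bsub>G\<^esub> j = \<one>\<^bsub>G\<^esub> \<longleftrightarrow> int m dvd i \<and> int n dvd j"
proof -
  interpret G: comm_group G using type by (simp add: has_abelian_type_def)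
  let ?I = "{..<length [m, n]}" and ?Z = "\<lambda>i. integer_mod_group ([m, n] ! i)"
  let ?P = "product_group ?I ?Z"
  obtain h where h: "h \<in> iso G ?P" using type by (auto simp: has_abelian_type_def is_iso_def)
  have P: "group ?P" by simp
  have hom: "h \<in> hom G ?P" and bij: "bij_betw h (carrier G) (carrier ?P)" using h by (auto simp: iso_def)
  interpret h: group_hom G ?P h
    using P hom by (simp add: group_hom_def group_hom_axioms_def G.is_group)
  have coord: "group_hom ?P (?Z i) (\<lambda>p. p i)" if "i \<in> ?I" for i
    unfolding group_hom_def group_hom_axioms_def using P that by (auto simp: hom_def)
  \<comment> \<open>Reducing both coordinates makes \<open>e a b\<close> a member of the product for
    all integers, including a unit vector that becomes zero because its modulus is 1.\<close>
  define e where "e a b = (\<lambda>i\<in>?I. if i = 0 then a mod int m else b mod int n)" for a b :: int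
  have e: "e a b \<in> carrier ?P" for a b
    using pos by (auto simp: e_def carrier_integer_mod_group less_Suc_eq)
  define k where "k = inv_into (carrier G) h"
  have k: "k p \<in> carrier G" "h (k p) = p" if "p \<in> carrier ?P" for p
    using bij that unfolding k_def bij_betw_def by (auto intro: inv_into_into f_inv_into_f simp del: carrier_product_group)
  let ?u = "k (e 1 0)" and ?v = "k (e 0 1)"
  have uv: "h (?u [^]\<^bsub>G\<^esub> i \<otimes>\<^bsub>G\<^esub> ?v [^]\<^bsub>G\<^esub> j) = e i j" for i j :: int
  proof -
    have "h (?u [^]\<^bsub>G\<^esub> i \<otimes>\<^bsub>G\<^esub> ?v [^]\<^bsub>G\<^esub> j) = e 1 0 [^]\<^bsub>?P\<^esub> i \<otimes>\<^bsub>?P\<^esub> e 0 1 [^]\<^bsub>?P\<^esub> j"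
      using k e h.hom_int_pow by (simp del: mult_product_group carrier_product_group)
    also have "\<dots> = e i j"
    proof
      fix l
      show "(e 1 0 [^]\<^bsub>?P\<^esub> i \<otimes>\<^bsub>?P\<^esub> e 0 1 [^]\<^bsub>?P\<^esub> j) l = e i j l"
      proof (cases "l \<in> ?I")
        case True
        interpret c: group_hom ?P "?Z l" "\<lambda>p. p l" by (rule coord[OF True])
        have "(e 1 0 [^]\<^bsub>?P\<^esub> i) l = (i * e 1 0 l) mod int ([m, n] ! l)"
          "(e 0 1 [^]\<^bsub>?P\<^esub> j) l = (j * e 0 1 l) mod int ([m, n] ! l)"
          using c.hom_int_pow[OF e] by (simp_all add: int_pow_integer_mod_group)
        then show ?thesis using True by (auto simp: e_def less_Suc_eq mod_simps)
      qed (auto simp: e_def)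
    qed
    finally show ?thesis .
  qed
  show thesis
  proof
    show u: "?u \<in> carrier G" and v: "?v \<in> carrier G" using k e by auto
    show "\<exists>(i::int) (j::int). x = ?u [^]\<^bsub>G\<^esub> i \<otimes>\<^bsub>G\<^esub> ?v [^]\<^bsub>G\<^esub> j" if x: "x \<in> carrier G" for x
    proof -
      have "h x \<in> carrier ?P" using x by (rule h.hom_closed)
      then have Z: "h x i \<in> carrier (?Z i)" if "i \<in> ?I" for i
        using that by (auto simp: PiE_iff)
      have "h x \<in> extensional ?I" using \<open>h x \<in> carrier ?P\<close> by (simp add: PiE_iff)
      moreover have "h x 0 \<in> {0..<int m}" "h x (Suc 0) \<in> {0..<int n}"
        using pos Z[of 0] Z[of 1] by (auto simp: carrier_integer_mod_group)
      ultimately have "h x = e (h x 0) (h x 1)"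
        unfolding e_def by (intro extensionalityI[of _ ?I]) (auto simp: less_Suc_eq)
      then have "h x = h (?u [^]\<^bsub>G\<^esub> (h x 0) \<otimes>\<^bsub>G\<^esub> ?v [^]\<^bsub>G\<^esub> (h x 1))" by (simp only: uv)
      then have "x = ?u [^]\<^bsub>G\<^esub> (h x 0) \<otimes>\<^bsub>G\<^esub> ?v [^]\<^bsub>G\<^esub> (h x 1)"
        using bij x u v by (intro inj_onD[of h "carrier G"]) (simp_all add: bij_betw_def)
      then show ?thesis by blast
    qed
    show "?u [^]\<^bsub>G\<^esub> i \<otimes>\<^bsub>G\<^esub> ?v [^]\<^bsub>G\<^esub> j = \<one>\<^bsub>G\<^esub> \<longleftrightarrow> int m dvd i \<and> int n dvd j" for i j :: int
    proof -
      have "?u [^]\<^bsub>G\<^esub> i \<otimes>\<^bsub>G\<^esub> ?v [^]\<^bsub>G\<^esub> j = \<one>\<^bsub>G\<^esub> \<longleftrightarrow> h (?u [^]\<^bsub>G\<^esub> i \<otimes>\<^bsub>G\<^esub> ?v [^]\<^bsub>G\<^esub> j) = h \<one>\<^bsub>G\<^esub>"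
        using bij u v by (intro inj_on_eq_iff[symmetric, of h "carrier G"]) (simp_all add: bij_betw_def)
      also have "\<dots> \<longleftrightarrow> e i j = e 0 0"
        unfolding uv h.hom_one by (auto simp: e_def fun_eq_iff)
      also have "\<dots> \<longleftrightarrow> int m dvd i \<and> int n dvd j"
        by (auto simp: e_def fun_eq_iff dvd_eq_mod_eq_0 split: if_splits)
      finally show ?thesis .
    qed
  qed
qed

lemma has_abelian_type_order:
  assumes "has_abelian_type G ns" "\<And>i. i < length ns \<Longrightarrow> ns ! i > 0"
  shows "order G = (\<Prod>i<length ns. ns ! i)"
proof -
  let ?P = "product_group {..<length ns} (\<lambda>i. integer_mod_group (ns ! i))"
  have "card (carrier G) = card (carrier ?P)"
    using assms(1) iso_same_card unfolding has_abelian_type_def by blast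
  also have "\<dots> = (\<Prod>i<length ns. card (carrier (integer_mod_group (ns ! i))))"
    by (simp add: card_PiE)
  also have "\<dots> = (\<Prod>i<length ns. ns ! i)"
    using assms(2) by (intro prod.cong) (auto simp: carrier_integer_mod_group)
  finally show ?thesis by (simp add: order_def)
qed

text \<open>Exponents count only modulo 2, which leaves four products. The bound excludes two
  generators for the elementary group of order 8.\<close>

lemma (in comm_group) order_le_four:
  assumes u: "u \<in> carrier G" and v: "v \<in> carrier G"
    and gen: "\<And>x. x \<in> carrier G \<Longrightarrow> \<exists>(i::int) (j::int). x = u [^] i \<otimes> v [^] j"
    and sq: "\<And>x. x \<in> carrier G \<Longrightarrow> x \<otimes> x = \<one>"
  shows "order G \<le> 4"
proof -
  have pow: "x [^] i = (if even i then \<one> else x)" if x: "x \<in> carrier G" for x and i :: int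
  proof -
    have "x [^] (2::nat) = \<one>" using sq[OF x] x by (simp add: numeral_2_eq_2)
    then have "x [^] (i mod 2) = x [^] i" using int_pow_mod[OF x, of 2 i] by simp
    then show ?thesis using x by (cases "even i") (simp_all add: even_iff_mod_2_eq_zero odd_iff_mod_2_eq_one)
  qed
  have "carrier G \<subseteq> set [\<one>, u, v, u \<otimes> v]"
  proof
    fix x assume "x \<in> carrier G"
    from gen[OF this] obtain i j :: int where "x = u [^] i \<otimes> v [^] j" by blast
    then show "x \<in> set [\<one>, u, v, u \<otimes> v]" using u v by (simp add: pow)
  qed
  then have "card (carrier G) \<le> card (set [\<one>, u, v, u \<otimes> v])" by (intro card_mono) simp_all
  also have "\<dots> \<le> 4" using card_length[of "[\<one>, u, v, u \<otimes> v]"] by simp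
  finally show ?thesis by (simp add: order_def)
qed

text \<open>In the application the group is \<open>M/M'\<close>, and \<open>\<alpha>\<close>,
  \<open>\<sigma>\<close>, \<open>\<gamma>\<close> are the images of \<open>a\<close>,
  \<open>b^2\<close>, \<open>c\<close>; \<open>indep\<close> expresses that \<open>a\<close> and
  \<open>b^2\<close> are a basis of \<open>M/G'\<close>. Outside the elementary case
  \<open>\<gamma>\<close> turns out to be a power of \<open>\<alpha>\<close> or of
  \<open>\<sigma>\<close>, and this is the information from which \<open>G\<close> is shown to be
  metacyclic.\<close>

lemma (in comm_group) abelian_type_cases:
  assumes ord: "order G = 2 ^ n"
    and cl: "\<alpha> \<in> carrier G" "\<sigma> \<in> carrier G" "\<gamma> \<in> carrier G"
    and gen: "\<And>x. x \<in> carrier G \<Longrightarrow>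
      \<exists>(i::int) (j::int) (k::int). x = \<alpha> [^] i \<otimes> \<sigma> [^] j \<otimes> \<gamma> [^] k"
    and indep: "\<And>(i::int) (j::int) (k::int). \<alpha> [^] i \<otimes> \<sigma> [^] j \<otimes> \<gamma> [^] k = \<one> \<Longrightarrow> even i \<and> even j"
    and \<alpha>2: "\<alpha> [^] (2::int) = \<gamma> [^] (r::int)" and \<sigma>2: "\<sigma> [^] (2::int) = \<gamma> [^] (s::int)"
    and \<gamma>r: "\<gamma> [^] (2 * (r + 1)) = \<one>"
  shows "(has_abelian_type G [2, 2, 2] \<and> (\<forall>x\<in>carrier G. x \<otimes> x = \<one>)) \<or>
    (\<exists>m\<ge>1. has_abelian_type G [2, 2 ^ m]) \<and> ((\<exists>l::int. \<gamma> = \<alpha> [^] l) \<or> (\<exists>l::int. \<gamma> = \<sigma> [^] l))"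
proof -
  have fin: "finite (carrier G)"
    using ord by (metis order_gt_0_iff_finite pos2 zero_less_power)
  have "ord \<gamma> dvd 2 ^ n" using ord_dvd_group_order[OF cl(3)] ord by simp
  then obtain t where t: "ord \<gamma> = 2 ^ t"
    using divides_primepow_nat two_is_prime_nat by blast
  have \<gamma>_one: "\<gamma> [^] k = \<one> \<longleftrightarrow> 2 ^ t dvd k" for k :: int
    using int_pow_eq_id[OF cl(3), of k] by (simp add: t)
  have sq: "x [^] (2::nat) = x [^] (2::int)" for x
    using int_pow_int[of G x 2] by simp
  have split2: "x [^] (2 * k) = (x [^] (2::int)) [^] k" if "x \<in> carrier G" for x and k :: int
    using that by (simp add: int_pow_pow)
  consider (odd) "odd r" | (even0) "even r" "t = 0" | (even1) "even r" "t \<noteq> 0" by blast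
  then show ?thesis
  proof cases
    case odd
    \<comment> \<open>\<open>r\<close> is invertible modulo the order \<open>2^t\<close> of
      \<open>\<gamma>\<close>, with inverse \<open>r'\<close>; hence
      \<open>\<gamma> = \<gamma>^(r r') = \<alpha>^(2 r')\<close>.\<close>
    have "coprime r (2 ^ t)" using odd by simp
    then obtain r' v where "r' * r + v * 2 ^ t = 1" using bezout_int[of r "2 ^ t"] by (auto simp: coprime_iff_gcd_eq_1)
    then have "1 - r * r' = 2 ^ t * v" by (simp add: algebra_simps)
    then have "2 ^ t dvd 1 - r * r'" by simp
    then have "\<gamma> [^] (r * r') = \<gamma> [^] (1::int)" using int_pow_eq[OF cl(3)] t by simp
    then have \<gamma>: "\<gamma> = \<alpha> [^] (2 * r')" using cl by (simp add: split2 \<alpha>2 int_pow_pow)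
    \<comment> \<open>Since \<open>\<sigma>^2 = \<gamma>^s = \<alpha>^(2 r' s)\<close>, dividing
      \<open>\<sigma>\<close> by \<open>\<alpha>^(r' s)\<close> leaves an element with trivial
      square that still generates the group together with \<open>\<alpha>\<close>.\<close>
    define w where "w = r' * s"
    define \<sigma>' where "\<sigma>' = \<sigma> \<otimes> \<alpha> [^] (- w)"
    have \<sigma>'cl: "\<sigma>' \<in> carrier G" using cl by (simp add: \<sigma>'_def)
    have \<sigma>'pow: "\<sigma>' [^] j = \<sigma> [^] j \<otimes> \<alpha> [^] (- w * j)" for j :: int
      using cl by (simp add: \<sigma>'_def int_pow_distrib int_pow_pow del: mult_minus_left)
    have \<sigma>'2: "\<sigma>' [^] (2::int) = \<one>"
    proof -
      have "\<sigma> [^] (2::int) = \<alpha> [^] (w * 2)" using cl by (simp add: \<sigma>2 \<gamma> int_pow_pow w_def ac_simps)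
      then show ?thesis unfolding \<sigma>'pow using cl by (simp add: int_pow_mult[symmetric])
    qed
    \<comment> \<open>\<open>\<alpha>^2 = \<gamma>^r\<close> has the same order \<open>2^t\<close>
      as \<open>\<gamma>\<close>, and odd powers of \<open>\<alpha>\<close> are nontrivial by
      \<open>indep\<close>; this doubles the order.\<close>
    have "has_abelian_type G [2, 2 ^ Suc t]"
    proof (rule has_abelian_type_two[OF \<sigma>'cl cl(1)])
      show "\<sigma>' [^] (2::nat) = \<one>" using \<sigma>'2 by (simp add: sq)
      have "\<alpha> [^] ((2::nat) ^ Suc t) = \<alpha> [^] (2 * 2 ^ t :: int)"
        using int_pow_int[of G \<alpha> "2 ^ Suc t"] by simp
      also have "\<dots> = \<gamma> [^] (r * 2 ^ t)" using cl by (simp add: split2 \<alpha>2 int_pow_pow)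
      also have "\<dots> = \<one>" by (simp add: \<gamma>_one)
      finally show "\<alpha> [^] ((2::nat) ^ Suc t) = \<one>" .
      show "\<exists>(i::int) (j::int). x = \<sigma>' [^] i \<otimes> \<alpha> [^] j" if "x \<in> carrier G" for x
      proof -
        from gen[OF that] obtain i j k :: int where x: "x = \<alpha> [^] i \<otimes> \<sigma> [^] j \<otimes> \<gamma> [^] k" by blast
        have "x = \<sigma> [^] j \<otimes> \<alpha> [^] (i + 2 * r' * k)"
          unfolding x \<gamma> using cl by (simp add: int_pow_mult int_pow_pow m_ac)
        also have "\<alpha> [^] (i + 2 * r' * k) = \<alpha> [^] (- w * j) \<otimes> \<alpha> [^] (w * j + (i + 2 * r' * k))"
          using cl by (simp add: int_pow_mult[symmetric])
        also have "\<sigma> [^] j \<otimes> \<dots> = \<sigma>' [^] j \<otimes> \<alpha> [^] (w * j + (i + 2 * r' * k))"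
          unfolding \<sigma>'pow using cl by (simp add: m_assoc)
        finally show ?thesis by blast
      qed
      show "int 2 dvd i \<and> int (2 ^ Suc t) dvd j" if *: "\<sigma>' [^] i \<otimes> \<alpha> [^] j = \<one>" for i j :: int
      proof -
        have "\<alpha> [^] (- w * i + j) \<otimes> \<sigma> [^] i \<otimes> \<gamma> [^] (0::int) = \<sigma>' [^] i \<otimes> \<alpha> [^] j"
          unfolding \<sigma>'pow using cl by (simp add: int_pow_mult m_ac del: mult_minus_left)
        with indep[of "- w * i + j" i 0] * have ev: "even (- w * i + j)" "even i" by auto
        then have "even j" by simp
        obtain i' where i': "i = 2 * i'" using ev(2) by blast
        obtain j' where j': "j = 2 * j'" using \<open>even j\<close> by blast
        have "\<sigma>' [^] i = \<one>" using \<sigma>'cl by (simp add: i' split2 \<sigma>'2)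
        then have "\<alpha> [^] j = \<one>" using * cl by simp
        then have "\<gamma> [^] (r * j') = \<one>" using cl by (simp add: j' split2 \<alpha>2 int_pow_pow)
        then have "2 ^ t dvd r * j'" by (simp add: \<gamma>_one)
        then have "2 ^ t dvd j'" using odd by (simp add: coprime_dvd_mult_right_iff)
        then show ?thesis using i' j' by simp
      qed
    qed (simp_all add: fin)
    then show ?thesis using \<gamma> by (metis One_nat_def le_add1 plus_1_eq_Suc)
  next
    case even0
    have one: "\<gamma> [^] k = \<one>" for k :: int using even0 by (simp add: \<gamma>_one)
    have \<gamma>: "\<gamma> = \<one>" using one[of 1] cl by simp
    have pow: "\<alpha> [^] (2::int) = \<one>" "\<sigma> [^] (2::int) = \<one>" by (simp_all add: \<alpha>2 \<sigma>2 one)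
    have "has_abelian_type G [2, 2]"
    proof (rule has_abelian_type_two[OF cl(1,2)])
      show "\<exists>(i::int) (j::int). x = \<alpha> [^] i \<otimes> \<sigma> [^] j" if "x \<in> carrier G" for x
        using gen[OF that] cl unfolding one by (metis int_pow_closed m_closed r_one)
      show "int 2 dvd i \<and> int 2 dvd j" if "\<alpha> [^] i \<otimes> \<sigma> [^] j = \<one>" for i j :: int
        using indep[of i j 0] that cl by simp
    qed (simp_all add: sq pow fin)
    then have "has_abelian_type G [2, 2 ^ 1]" by simp
    moreover have "\<gamma> = \<alpha> [^] (0::int)" using \<gamma> by simp
    ultimately show ?thesis by blast
  next
    case even1
    have "2 ^ t dvd 2 * (r + 1)" using \<gamma>r by (simp add: \<gamma>_one)
    \<comment> \<open>As \<open>r + 1\<close> is odd, \<open>2^t\<close> divides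
      \<open>2 * (r + 1)\<close> only for \<open>t\<close> at most 1.\<close>
    have "t = 1"
    proof (rule ccontr)
      assume "t \<noteq> 1"
      with even1 have "2 \<le> t" by simp
      then have "(2::int) ^ 2 dvd 2 ^ t" by (rule le_imp_power_dvd)
      then have "(2::int) * 2 dvd 2 * (r + 1)" using \<open>2 ^ t dvd 2 * (r + 1)\<close> by (metis dvd_trans power2_eq_square)
      then show False using even1(1) by presburger
    qed
    then have \<gamma>_one: "\<gamma> [^] k = \<one> \<longleftrightarrow> even k" for k :: int by (simp add: \<gamma>_one)
    have \<gamma>2: "\<gamma> [^] (2::int) = \<one>" by (simp add: \<gamma>_one)
    have \<alpha>_one: "\<alpha> [^] (2::int) = \<one>" using even1 by (simp add: \<alpha>2 \<gamma>_one)
    have kill: "x [^] k = \<one>" if "even k" "x \<in> carrier G" "x [^] (2::int) = \<one>" for x and k :: int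
      using that split2 by (metis evenE int_pow_one)
    \<comment> \<open>Now \<open>\<gamma>\<close> has order 2 and \<open>\<alpha>^2\<close> is
      trivial, so \<open>\<sigma>^2\<close> is \<open>\<one>\<close> or \<open>\<gamma>\<close>. In
      the second case \<open>\<gamma>\<close> is redundant as a generator and
      \<open>\<sigma>\<close> has order 4.\<close>
    show ?thesis
    proof (cases "even s")
      case True
      then have \<sigma>_one: "\<sigma> [^] (2::int) = \<one>" by (simp add: \<sigma>2 \<gamma>_one)
      have "has_abelian_type G [2, 2, 2]"
      proof (rule has_abelian_type_three[OF cl])
        show "int 2 dvd i \<and> int 2 dvd j \<and> int 2 dvd k"
          if *: "\<alpha> [^] i \<otimes> \<sigma> [^] j \<otimes> \<gamma> [^] k = \<one>" for i j k :: int
        proof -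
          have ev: "even i" "even j" using indep[OF *] by auto
          then have "\<gamma> [^] k = \<one>" using * cl by (simp add: kill \<alpha>_one \<sigma>_one)
          then show ?thesis using ev by (simp add: \<gamma>_one)
        qed
      qed (simp_all add: sq \<alpha>_one \<sigma>_one \<gamma>2 fin gen)
      moreover have "x \<otimes> x = \<one>" if x: "x \<in> carrier G" for x
      proof -
        from gen[OF x] obtain i j k :: int where "x = \<alpha> [^] i \<otimes> \<sigma> [^] j \<otimes> \<gamma> [^] k" by blast
        then have "x [^] (2::int) = \<one>"
          using cl by (simp add: int_pow_distrib int_pow_pow kill \<alpha>_one \<sigma>_one \<gamma>2)
        then show ?thesis using x by (simp add: sq[symmetric] numeral_2_eq_2)
      qed
      ultimately show ?thesis by blast
    next
      case False
      have \<gamma>: "\<gamma> = \<sigma> [^] (2::int)"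
      proof -
        have "\<gamma> [^] (s - 1) = \<one>" using False by (simp add: \<gamma>_one)
        then have "\<gamma> [^] s = \<gamma>" using cl int_pow_mult[OF cl(3), of "s - 1" 1] by simp
        then show ?thesis by (simp add: \<sigma>2)
      qed
      have "has_abelian_type G [2, 2 ^ 2]"
      proof (rule has_abelian_type_two[OF cl(1,2)])
        show "\<exists>(i::int) (j::int). x = \<alpha> [^] i \<otimes> \<sigma> [^] j" if "x \<in> carrier G" for x
        proof -
          from gen[OF that] obtain i j k :: int where "x = \<alpha> [^] i \<otimes> \<sigma> [^] j \<otimes> \<gamma> [^] k" by blast
          then have "x = \<alpha> [^] i \<otimes> \<sigma> [^] (j + 2 * k)"
            unfolding \<gamma> using cl by (simp add: int_pow_mult int_pow_pow m_ac)
          then show ?thesis by blast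
        qed
        have "\<sigma> [^] ((2::nat) ^ 2) = \<sigma> [^] (2 * 2 :: int)"
          using int_pow_int[of G \<sigma> "2 ^ 2"] by simp
        also have "\<dots> = \<one>" using cl by (simp only: split2 \<gamma>[symmetric] \<gamma>2)
        finally show "\<sigma> [^] ((2::nat) ^ 2) = \<one>" .
        show "int 2 dvd i \<and> int (2 ^ 2) dvd j" if *: "\<alpha> [^] i \<otimes> \<sigma> [^] j = \<one>" for i j :: int
        proof -
          have ev: "even i" "even j" using indep[of i j 0] * cl by simp_all
          then obtain j' where j': "j = 2 * j'" by blast
          have "\<sigma> [^] j = \<one>" using * ev cl by (simp add: kill \<alpha>_one)
          then have "\<gamma> [^] j' = \<one>" using cl by (simp only: j' split2 \<gamma>[symmetric])
          then have "4 dvd j" by (auto simp: \<gamma>_one j')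
          then show ?thesis using ev by simp
        qed
      qed (simp_all add: sq \<alpha>_one fin)
      then show ?thesis using \<gamma> by (metis one_le_numeral)
    qed
  qed
qed

section \<open>Groups with abelianization of type (2, 4)\<close>

lemma (in group) commute_mult:
  assumes "x \<otimes> z = z \<otimes> x" "y \<otimes> z = z \<otimes> y" "x \<in> carrier G" "y \<in> carrier G" "z \<in> carrier G"
  shows "(x \<otimes> y) \<otimes> z = z \<otimes> (x \<otimes> y)"
proof -
  have "(x \<otimes> y) \<otimes> z = x \<otimes> z \<otimes> y" using assms(3-5) by (simp add: m_assoc assms(2))
  also have "\<dots> = z \<otimes> (x \<otimes> y)" using assms(3-5) by (simp add: m_assoc assms(1))
  finally show ?thesis .
qed

lemma (in group) commute_int_pow:
  assumes "x \<otimes> z = z \<otimes> x" "x \<in> carrier G" "z \<in> carrier G"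
  shows "x [^] (i::int) \<otimes> z = z \<otimes> x [^] i"
proof (cases i rule: int_cases2)
  case (nonneg n)
  then show ?thesis using group_commutes_pow[OF assms] by (simp add: int_pow_int)
next
  case (nonpos n)
  have "z \<otimes> x [^] n = x [^] n \<otimes> z" using group_commutes_pow[OF assms] by simp
  then show ?thesis using assms(2,3) commute_inv[of z "x [^] n"]
    by (simp add: nonpos int_pow_neg_int)
qed

lemma (in group) inv_mult_cancel_left [simp]:
  assumes "x \<in> carrier G" "y \<in> carrier G"
  shows "inv x \<otimes> (x \<otimes> y) = y" "x \<otimes> (inv x \<otimes> y) = y"
  using assms by (simp_all add: m_assoc[symmetric])

text \<open>Together with \<open>hom_commute_if_commutator\<close> this passes between commutators
  in a kernel and commuting images. Containments of \<open>G'\<close> or \<open>M'\<close> in a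
  normal subgroup are proved in this way.\<close>

lemma (in group_hom) derived_in_kernel:
  assumes "M \<subseteq> carrier G" and "\<And>x y. x \<in> M \<Longrightarrow> y \<in> M \<Longrightarrow> h x \<otimes>\<^bsub>H\<^esub> h y = h y \<otimes>\<^bsub>H\<^esub> h x"
    and "d \<in> derived G M"
  shows "h d = \<one>\<^bsub>H\<^esub>"
proof -
  have "derived_set G M \<subseteq> kernel G H h"
  proof (clarsimp simp: kernel_def, intro conjI)
    fix x y assume xy: "x \<in> M" "y \<in> M"
    then have cl: "x \<in> carrier G" "y \<in> carrier G" using assms(1) by auto
    then show "x \<otimes> y \<otimes> inv x \<otimes> inv y \<in> carrier G" by simp
    show "h (x \<otimes> y \<otimes> inv x \<otimes> inv y) = \<one>\<^bsub>H\<^esub>"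
      using H.conj_commute[OF assms(2)[OF xy]] cl by simp
  qed
  then have "derived G M \<subseteq> kernel G H h"
    unfolding derived_def using G.generate_subgroup_incl subgroup_kernel by blast
  then show ?thesis using assms(3) by (auto simp: kernel_def)
qed

lemma (in group) commutator_in_derived:
  assumes "x \<in> M" "y \<in> M"
  shows "x \<otimes> y \<otimes> inv x \<otimes> inv y \<in> derived G M"
  using assms unfolding derived_def by (blast intro: generate.incl)

lemma (in group) hom_commute_if_commutator:
  assumes "group_hom G H h" "x \<in> carrier G" "y \<in> carrier G"
    and "h (x \<otimes> y \<otimes> inv x \<otimes> inv y) = \<one>\<^bsub>H\<^esub>"
  shows "h x \<otimes>\<^bsub>H\<^esub> h y = h y \<otimes>\<^bsub>H\<^esub> h x"
proof -
  interpret h: group_hom G H h by fact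
  have "h x \<otimes>\<^bsub>H\<^esub> h y = h (x \<otimes> y \<otimes> inv x \<otimes> inv y) \<otimes>\<^bsub>H\<^esub> (h y \<otimes>\<^bsub>H\<^esub> h x)"
    using assms(2,3) by (simp add: h.H.m_assoc)
  then show ?thesis using assms by simp
qed

section \<open>Coordinates modulo G' and the subgroup M\<close>

locale two_four_group = group G for G (structure) +
  fixes a b :: 'a and n :: nat
  assumes ord: "order G = 2 ^ n"
    and a [simp]: "a \<in> carrier G" and b [simp]: "b \<in> carrier G"
    and gen: "x \<in> carrier G \<Longrightarrow>
      \<exists>(i::int) (j::int). \<exists>d\<in>derived G (carrier G). x = a [^] i \<otimes> b [^] j \<otimes> d"
    and indep: "a [^] (i::int) \<otimes> b [^] (j::int) \<in> derived G (carrier G) \<longleftrightarrow> even i \<and> 4 dvd j"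
begin

abbreviation D where "D \<equiv> derived G (carrier G)"

text \<open>The preimage of the elements of order at most 2 in \<open>G/G'\<close>; in a group of
  type \<open>(2, 4)\<close> they form the subgroup of type \<open>(2, 2)\<close>. In this form
  \<open>M\<close> is independent of the choice of \<open>a\<close> and \<open>b\<close>.\<close>

definition M where "M = {x \<in> carrier G. x \<otimes> x \<in> D}"

sublocale D: normal D G
  by (rule derived_self_is_normal)

lemma abelian_quotient:
  obtains Q :: "'a set monoid" and f where "group_hom G Q f" "comm_group Q"
    "\<And>x. x \<in> carrier G \<Longrightarrow> f x = \<one>\<^bsub>Q\<^esub> \<longleftrightarrow> x \<in> D"
proof -
  obtain Q :: "'a set monoid" and f where Q: "group_hom G Q f" "f ` carrier G = carrier Q"
    "\<And>x. x \<in> carrier G \<Longrightarrow> f x = \<one>\<^bsub>Q\<^esub> \<longleftrightarrow> x \<in> D" "order Q * card D = order G"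
    by (rule D.obtain_quotient_hom) (rule that)
  interpret f: group_hom G Q f by fact
  have "comm_group Q"
  proof (rule f.H.group_comm_groupI)
    fix x y assume "x \<in> carrier Q" "y \<in> carrier Q"
    then have "x \<in> f ` carrier G" "y \<in> f ` carrier G" by (simp_all only: Q(2))
    then obtain u v where uv: "u \<in> carrier G" "v \<in> carrier G" "x = f u" "y = f v"
      by auto
    have "f (u \<otimes> v \<otimes> inv u \<otimes> inv v) = \<one>\<^bsub>Q\<^esub>"
      using uv by (subst Q(3)) (simp_all add: commutator_in_derived)
    then show "x \<otimes>\<^bsub>Q\<^esub> y = y \<otimes>\<^bsub>Q\<^esub> x"
      using hom_commute_if_commutator[OF Q(1)] uv by simp
  qed
  with Q(1,3) show thesis by (intro that)
qed

text \<open>In the abelian quotient \<open>G/G'\<close> the factor \<open>d\<close> vanishes and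
  squaring doubles both exponents; \<open>2j\<close> is divisible by 4 exactly for even
  \<open>j\<close>.\<close>

lemma in_derived_iff:
  assumes "d \<in> D"
  shows "a [^] (i::int) \<otimes> b [^] (j::int) \<otimes> d \<in> D \<longleftrightarrow> even i \<and> 4 dvd j"
    and "(a [^] i \<otimes> b [^] j \<otimes> d) \<otimes> (a [^] i \<otimes> b [^] j \<otimes> d) \<in> D \<longleftrightarrow> even j"
proof -
  obtain Q :: "'a set monoid" and f where f: "group_hom G Q f" and "comm_group Q"
    and ker: "\<And>x. x \<in> carrier G \<Longrightarrow> f x = \<one>\<^bsub>Q\<^esub> \<longleftrightarrow> x \<in> D"
    by (rule abelian_quotient) (rule that)
  interpret f: group_hom G Q f by fact
  interpret Q: comm_group Q by fact
  have d: "d \<in> carrier G" "f d = \<one>\<^bsub>Q\<^esub>" using assms D.subset ker by auto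
  have "f (a [^] i \<otimes> b [^] j \<otimes> d) = f (a [^] i \<otimes> b [^] j)"
    using d by simp
  then show "a [^] i \<otimes> b [^] j \<otimes> d \<in> D \<longleftrightarrow> even i \<and> 4 dvd j"
    using indep[of i j] d(1) ker[of "a [^] i \<otimes> b [^] j \<otimes> d"] ker[of "a [^] i \<otimes> b [^] j"] by simp
  have "f ((a [^] i \<otimes> b [^] j \<otimes> d) \<otimes> (a [^] i \<otimes> b [^] j \<otimes> d)) = f (a [^] (i + i) \<otimes> b [^] (j + j))"
    using d by (simp only: int_pow_mult a b) (simp add: Q.m_ac)
  then have "(a [^] i \<otimes> b [^] j \<otimes> d) \<otimes> (a [^] i \<otimes> b [^] j \<otimes> d) \<in> D \<longleftrightarrow> a [^] (i + i) \<otimes> b [^] (j + j) \<in> D"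
    using ker[of "(a [^] i \<otimes> b [^] j \<otimes> d) \<otimes> (a [^] i \<otimes> b [^] j \<otimes> d)"] ker[of "a [^] (i + i) \<otimes> b [^] (j + j)"] d(1)
    by simp
  then show "(a [^] i \<otimes> b [^] j \<otimes> d) \<otimes> (a [^] i \<otimes> b [^] j \<otimes> d) \<in> D \<longleftrightarrow> even j"
    unfolding indep by presburger
qed

lemma derived_subset_M: "D \<subseteq> M"
  using D.subset by (auto simp: M_def)

lemma M_subset: "M \<subseteq> carrier G"
  by (auto simp: M_def)

lemma M_normal: "M \<lhd> G"
proof (subst normal_inv_iff, intro conjI ballI)
  obtain Q :: "'a set monoid" and f where f: "group_hom G Q f" and "comm_group Q"
    and ker: "\<And>x. x \<in> carrier G \<Longrightarrow> f x = \<one>\<^bsub>Q\<^esub> \<longleftrightarrow> x \<in> D"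
    by (rule abelian_quotient) (rule that)
  interpret f: group_hom G Q f by fact
  interpret Q: comm_group Q by fact
  have M: "x \<in> M \<longleftrightarrow> f x \<otimes>\<^bsub>Q\<^esub> f x = \<one>\<^bsub>Q\<^esub>" if "x \<in> carrier G" for x
    using that by (simp add: M_def ker[symmetric])
  show "subgroup M G"
  proof
    fix x y assume "x \<in> M" "y \<in> M"
    then have xy: "x \<in> carrier G" "y \<in> carrier G" "f x \<otimes>\<^bsub>Q\<^esub> f x = \<one>\<^bsub>Q\<^esub>" "f y \<otimes>\<^bsub>Q\<^esub> f y = \<one>\<^bsub>Q\<^esub>"
      using M M_subset by auto
    have "f (x \<otimes> y) \<otimes>\<^bsub>Q\<^esub> f (x \<otimes> y) = (f x \<otimes>\<^bsub>Q\<^esub> f x) \<otimes>\<^bsub>Q\<^esub> (f y \<otimes>\<^bsub>Q\<^esub> f y)"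
      using xy(1,2) by (simp add: Q.m_ac)
    then show "x \<otimes> y \<in> M" using xy M by simp
  next
    fix x assume "x \<in> M"
    then have x: "x \<in> carrier G" "f x \<otimes>\<^bsub>Q\<^esub> f x = \<one>\<^bsub>Q\<^esub>" using M M_subset by auto
    have "f (inv x) \<otimes>\<^bsub>Q\<^esub> f (inv x) = inv\<^bsub>Q\<^esub> (f x \<otimes>\<^bsub>Q\<^esub> f x)"
      using x(1) by (simp add: Q.inv_mult)
    then show "inv x \<in> M" using x M by simp
  qed (use M_subset M in auto)
  fix g x assume g: "g \<in> carrier G" and x: "x \<in> M"
  then have xG: "x \<in> carrier G" using M_subset by auto
  have "f (g \<otimes> x \<otimes> inv g) = f x"
    using g xG f.H.conj_commute[of "f g" "f x"] Q.m_comm[of "f g" "f x"] by simp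
  then show "g \<otimes> x \<otimes> inv g \<in> M" using M[OF xG] M[of "g \<otimes> x \<otimes> inv g"] g x xG by simp
qed

sublocale M: normal M G
  by (rule M_normal)

lemma in_M_iff:
  assumes "d \<in> D"
  shows "a [^] (i::int) \<otimes> b [^] (j::int) \<otimes> d \<in> M \<longleftrightarrow> even j"
  using in_derived_iff(2)[OF assms, of i j] D.mem_carrier[OF assms] unfolding M_def by simp

lemma M_cases:
  assumes "x \<in> M"
  obtains i j :: int and d where "d \<in> D" "x = a [^] i \<otimes> b [^] (2 * j) \<otimes> d"
proof -
  have "x \<in> carrier G" using assms M_subset by blast
  from gen[OF this] obtain i j :: int and d where x: "d \<in> D" "x = a [^] i \<otimes> b [^] j \<otimes> d" by blast
  then have "even j" using assms in_M_iff by blast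
  then show thesis using that x by (elim evenE) blast
qed

lemma a_in_M [simp]: "a \<in> M" and b_notin_M: "b \<notin> M" and b_sq_in_M [simp]: "b \<otimes> b \<in> M"
  using in_M_iff[of \<one> 1 0] in_M_iff[of \<one> 0 1] in_M_iff[of \<one> 0 2]
    int_pow_mult[OF b, of 1 1] by (simp_all add: D.one_closed)

text \<open>Outside \<open>M\<close> the exponent of \<open>b\<close> is odd, and division by
  \<open>b\<close> makes it even. Thus \<open>\<one>\<close> and \<open>b\<close> represent all
  cosets of \<open>M\<close>.\<close>

lemma M_index:
  assumes "x \<in> carrier G" "x \<notin> M"
  shows "inv b \<otimes> x \<in> M"
proof -
  from gen[OF assms(1)] obtain i j :: int and d where x: "d \<in> D" "x = a [^] i \<otimes> b [^] j \<otimes> d" by blast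
  have "odd j" using x assms(2) in_M_iff by blast
  obtain Q :: "'a set monoid" and f where f: "group_hom G Q f" and "comm_group Q"
    and ker: "\<And>x. x \<in> carrier G \<Longrightarrow> f x = \<one>\<^bsub>Q\<^esub> \<longleftrightarrow> x \<in> D"
    by (rule abelian_quotient) (rule that)
  interpret f: group_hom G Q f by fact
  interpret Q: comm_group Q by fact
  have d: "d \<in> carrier G" "f d = \<one>\<^bsub>Q\<^esub>" using x(1) D.subset ker by auto
  have "f (inv b \<otimes> x) = f (a [^] i \<otimes> b [^] (j - 1) \<otimes> \<one>)"
    unfolding x(2) using d by (simp add: int_pow_diff Q.m_ac)
  then have "f ((inv b \<otimes> x) \<otimes> (inv b \<otimes> x)) = f ((a [^] i \<otimes> b [^] (j - 1) \<otimes> \<one>) \<otimes> (a [^] i \<otimes> b [^] (j - 1) \<otimes> \<one>))"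
    using assms(1) by (simp del: r_one)
  moreover have "f ((a [^] i \<otimes> b [^] (j - 1) \<otimes> \<one>) \<otimes> (a [^] i \<otimes> b [^] (j - 1) \<otimes> \<one>)) = \<one>\<^bsub>Q\<^esub>"
    using in_derived_iff(2)[OF D.one_closed, of i "j - 1"] \<open>odd j\<close> by (subst ker) simp_all
  ultimately have "(inv b \<otimes> x) \<otimes> (inv b \<otimes> x) \<in> D"
    using ker[of "(inv b \<otimes> x) \<otimes> (inv b \<otimes> x)"] assms(1) by simp
  then show ?thesis using assms(1) unfolding M_def by simp
qed

lemma M_mult:
  assumes "x \<in> carrier G" "x \<notin> M" "y \<in> carrier G" "y \<notin> M"
  shows "x \<otimes> y \<in> M"
proof -
  let ?x = "inv b \<otimes> x" and ?y = "inv b \<otimes> y"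
  have xy: "?x \<in> M" "?y \<in> M" using assms M_index by auto
  \<comment> \<open>The product \<open>xy = b ?x b ?y\<close> is regrouped as
    \<open>b^2 (b^-1 ?x b) ?y\<close>, whose factors all lie in the normal subgroup
    \<open>M\<close>.\<close>
  then have "(b \<otimes> b) \<otimes> (inv b \<otimes> ?x \<otimes> b) \<otimes> ?y \<in> M"
    using M.inv_op_closed1[OF b] by simp
  then show ?thesis using assms by (simp add: m_assoc)
qed

end

section \<open>The quotient by M'\<close>

lemma (in group_hom) range_pow_subgroup:
  assumes "c \<in> carrier H"
  shows "subgroup {x \<in> carrier G. \<exists>k::int. h x = c [^]\<^bsub>H\<^esub> k} G"
proof
  fix x y assume "x \<in> {x \<in> carrier G. \<exists>k::int. h x = c [^]\<^bsub>H\<^esub> k}" "y \<in> {x \<in> carrier G. \<exists>k::int. h x = c [^]\<^bsub>H\<^esub> k}"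
  then obtain k l :: int where "x \<in> carrier G" "y \<in> carrier G" "h x = c [^]\<^bsub>H\<^esub> k" "h y = c [^]\<^bsub>H\<^esub> l" by blast
  then show "x \<otimes> y \<in> {x \<in> carrier G. \<exists>k::int. h x = c [^]\<^bsub>H\<^esub> k}"
    using H.int_pow_mult[OF assms, of k l] by (auto intro!: exI[of _ "k + l"])
next
  fix x assume "x \<in> {x \<in> carrier G. \<exists>k::int. h x = c [^]\<^bsub>H\<^esub> k}"
  then obtain k :: int where "x \<in> carrier G" "h x = c [^]\<^bsub>H\<^esub> k" by blast
  then show "inv x \<in> {x \<in> carrier G. \<exists>k::int. h x = c [^]\<^bsub>H\<^esub> k}"
    using H.int_pow_neg[OF assms, of k] by (auto intro!: exI[of _ "- k"])
qed (auto intro: exI[of _ "0::int"])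

lemma (in group) conj_int_pow:
  assumes "g \<in> carrier G" "x \<in> carrier G"
  shows "g \<otimes> x [^] (k::int) \<otimes> inv g = (g \<otimes> x \<otimes> inv g) [^] k"
proof -
  interpret c: group_hom G G "\<lambda>x. g \<otimes> x \<otimes> inv g"
    using assms(1) by unfold_locales (auto simp: hom_def m_assoc)
  show ?thesis using c.hom_int_pow[OF assms(2)] .
qed

context two_four_group
begin

abbreviation M' where "M' \<equiv> derived G M"

definition c where "c = b \<otimes> a \<otimes> inv b \<otimes> inv a"

sublocale M': normal M' G
  by (rule derived_is_normal[OF M_normal])

lemma M'_subset_D: "M' \<subseteq> D"
  by (rule mono_derived[OF M_subset])

lemma c_in_D: "c \<in> D"
  unfolding c_def by (rule commutator_in_derived) simp_all

lemma c_closed [simp]: "c \<in> carrier G"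
  using c_in_D D.subset by blast

lemma hom_commute_on_M:
  assumes "group_hom G H h" "\<And>x. x \<in> M' \<Longrightarrow> h x = \<one>\<^bsub>H\<^esub>" "x \<in> M" "y \<in> M"
  shows "h x \<otimes>\<^bsub>H\<^esub> h y = h y \<otimes>\<^bsub>H\<^esub> h x"
  using assms(3,4) M_subset commutator_in_derived[OF assms(3,4)]
  by (intro hom_commute_if_commutator[OF assms(1)] assms(2)) auto

text \<open>Both \<open>b^2\<close> and \<open>a\<close> lie in \<open>M\<close>, so they commute
  modulo \<open>M'\<close>. In \<open>b c b^-1 = (b^2 a b^-2)(b a^-1 b^-1)\<close> the first factor
  is therefore \<open>a\<close>, and what remains is \<open>c^-1\<close>.\<close>

lemma conj_b_c:
  assumes "group_hom G H h" "\<And>x. x \<in> M' \<Longrightarrow> h x = \<one>\<^bsub>H\<^esub>"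
  shows "h b \<otimes>\<^bsub>H\<^esub> h c \<otimes>\<^bsub>H\<^esub> inv\<^bsub>H\<^esub> h b = inv\<^bsub>H\<^esub> h c"
proof -
  interpret h: group_hom G H h by fact
  have bb: "h b \<otimes>\<^bsub>H\<^esub> h b \<otimes>\<^bsub>H\<^esub> h a \<otimes>\<^bsub>H\<^esub> inv\<^bsub>H\<^esub> (h b \<otimes>\<^bsub>H\<^esub> h b) = h a"
    using h.H.conj_commute[of "h b \<otimes>\<^bsub>H\<^esub> h b" "h a"] hom_commute_on_M[OF assms b_sq_in_M a_in_M] by simp
  have "h b \<otimes>\<^bsub>H\<^esub> h c \<otimes>\<^bsub>H\<^esub> inv\<^bsub>H\<^esub> h b = (h b \<otimes>\<^bsub>H\<^esub> h b \<otimes>\<^bsub>H\<^esub> h a \<otimes>\<^bsub>H\<^esub> inv\<^bsub>H\<^esub> (h b \<otimes>\<^bsub>H\<^esub> h b))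
      \<otimes>\<^bsub>H\<^esub> (h b \<otimes>\<^bsub>H\<^esub> inv\<^bsub>H\<^esub> h a \<otimes>\<^bsub>H\<^esub> inv\<^bsub>H\<^esub> h b)"
    by (simp add: c_def h.H.m_assoc h.H.inv_mult_group)
  also have "\<dots> = h a \<otimes>\<^bsub>H\<^esub> (h b \<otimes>\<^bsub>H\<^esub> inv\<^bsub>H\<^esub> h a \<otimes>\<^bsub>H\<^esub> inv\<^bsub>H\<^esub> h b)"
    unfolding bb ..
  also have "\<dots> = inv\<^bsub>H\<^esub> h c"
    by (simp add: c_def h.H.m_assoc h.H.inv_mult_group)
  finally show ?thesis .
qed

text \<open>The subgroup \<open>R = <c>M'\<close> is normal, since modulo \<open>M'\<close> the
  elements of \<open>M\<close> centralize \<open>c\<close> and \<open>b\<close> inverts it. If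
  \<open>R\<close> did not contain \<open>G'\<close>, there would be a \<open>T\<close> between
  \<open>R \<inter> G'\<close> and \<open>G'\<close>, properly below \<open>G'\<close>, with
  \<open>G'/T\<close> central. Then \<open>G/T\<close> is generated by the commuting images of
  \<open>a\<close> and \<open>b\<close> and by central elements, so it is abelian and
  \<open>G'\<close> lies in \<open>T\<close>, a contradiction.\<close>

lemma derived_subset_pow_c:
  assumes "d \<in> D"
  shows "\<exists>k::int. inv (c [^] k) \<otimes> d \<in> M'"
proof -
  obtain H :: "'a set monoid" and h where hom: "group_hom G H h" and surj: "h ` carrier G = carrier H"
    and ker: "\<And>x. x \<in> carrier G \<Longrightarrow> h x = \<one>\<^bsub>H\<^esub> \<longleftrightarrow> x \<in> M'" and "order H * card M' = order G"
    by (rule M'.obtain_quotient_hom) (rule that)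
  interpret h: group_hom G H h by fact
  have hM': "h x = \<one>\<^bsub>H\<^esub>" if "x \<in> M'" for x
    using that ker M'.subset by blast
  define R where "R = {x \<in> carrier G. \<exists>k::int. h x = h c [^]\<^bsub>H\<^esub> k}"
  have "R \<lhd> G"
  proof (subst normal_inv_iff, intro conjI ballI)
    show "subgroup R G"
      unfolding R_def by (rule h.range_pow_subgroup) simp
    fix g x assume g: "g \<in> carrier G" and "x \<in> R"
    then obtain k :: int where x: "x \<in> carrier G" "h x = h c [^]\<^bsub>H\<^esub> k" by (auto simp: R_def)
    have mc: "h m \<otimes>\<^bsub>H\<^esub> h c \<otimes>\<^bsub>H\<^esub> inv\<^bsub>H\<^esub> h m = h c" if "m \<in> M" for m
      using that M_subset c_in_D derived_subset_M
      by (intro h.H.conj_commute hom_commute_on_M[OF hom hM']) auto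
    have "h g \<otimes>\<^bsub>H\<^esub> h c \<otimes>\<^bsub>H\<^esub> inv\<^bsub>H\<^esub> h g = h c \<or> h g \<otimes>\<^bsub>H\<^esub> h c \<otimes>\<^bsub>H\<^esub> inv\<^bsub>H\<^esub> h g = inv\<^bsub>H\<^esub> h c"
    proof (cases "g \<in> M")
      case False
      let ?m = "inv b \<otimes> g"
      have m: "?m \<in> M" "?m \<in> carrier G" using M_index[OF g False] g by auto
      have "g = b \<otimes> ?m" using g by simp
      then have "h g = h b \<otimes>\<^bsub>H\<^esub> h ?m" using m(2) by (metis h.hom_mult b)
      then have "h g \<otimes>\<^bsub>H\<^esub> h c \<otimes>\<^bsub>H\<^esub> inv\<^bsub>H\<^esub> h g = h b \<otimes>\<^bsub>H\<^esub> (h ?m \<otimes>\<^bsub>H\<^esub> h c \<otimes>\<^bsub>H\<^esub> inv\<^bsub>H\<^esub> h ?m) \<otimes>\<^bsub>H\<^esub> inv\<^bsub>H\<^esub> h b"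
        using m(2) by (simp add: h.H.m_assoc h.H.inv_mult_group del: h.hom_mult)
      then show ?thesis unfolding mc[OF m(1)] using conj_b_c[OF hom hM'] by simp
    qed (use mc in blast)
    then have "\<exists>l::int. h (g \<otimes> x \<otimes> inv g) = h c [^]\<^bsub>H\<^esub> l"
    proof
      assume "h g \<otimes>\<^bsub>H\<^esub> h c \<otimes>\<^bsub>H\<^esub> inv\<^bsub>H\<^esub> h g = h c"
      then have "h (g \<otimes> x \<otimes> inv g) = h c [^]\<^bsub>H\<^esub> k"
        using h.H.conj_int_pow[of "h g" "h c" k] g x by simp
      then show ?thesis by blast
    next
      assume "h g \<otimes>\<^bsub>H\<^esub> h c \<otimes>\<^bsub>H\<^esub> inv\<^bsub>H\<^esub> h g = inv\<^bsub>H\<^esub> h c"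
      then have "h (g \<otimes> x \<otimes> inv g) = h c [^]\<^bsub>H\<^esub> (- k)"
        using h.H.conj_int_pow[of "h g" "h c" k] g x by (simp add: h.H.int_pow_inv h.H.int_pow_neg)
      then show ?thesis by blast
    qed
    then show "g \<otimes> x \<otimes> inv g \<in> R" using g x by (simp add: R_def)
  qed
  then have RD: "R \<inter> D \<lhd> G" using D.normal_axioms by (rule normal_subgroup_intersect)
  have cR: "c \<in> R \<inter> D" using c_in_D by (auto simp: R_def intro!: exI[of _ "1::int"])
  have "R \<inter> D = D"
  proof (rule ccontr)
    assume "R \<inter> D \<noteq> D"
    then have "R \<inter> D \<subset> D" by blast
    then obtain T where T: "T \<lhd> G" "R \<inter> D \<subseteq> T" "T \<subset> D"
      "\<And>n g. n \<in> D \<Longrightarrow> g \<in> carrier G \<Longrightarrow> g \<otimes> n \<otimes> inv g \<otimes> inv n \<in> T"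
      by (rule chief_step[OF ord RD D.normal_axioms]) (rule that)
    interpret T: normal T G by fact
    obtain Q :: "'a set monoid" and q where Q: "group_hom G Q q" "q ` carrier G = carrier Q"
      "\<And>x. x \<in> carrier G \<Longrightarrow> q x = \<one>\<^bsub>Q\<^esub> \<longleftrightarrow> x \<in> T" "order Q * card T = order G"
      by (rule T.obtain_quotient_hom) (rule that)
    interpret q: group_hom G Q q by fact
    have qT: "q x = \<one>\<^bsub>Q\<^esub>" if "x \<in> T" for x
      using that Q(3) T.subset by blast
    have qd: "q g \<otimes>\<^bsub>Q\<^esub> q d = q d \<otimes>\<^bsub>Q\<^esub> q g" if "d \<in> D" "g \<in> carrier G" for d g
      using that D.mem_carrier qT[OF T(4)] by (intro hom_commute_if_commutator[OF Q(1)]) auto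
    have ba: "q b \<otimes>\<^bsub>Q\<^esub> q a = q a \<otimes>\<^bsub>Q\<^esub> q b"
      using qT[of c] cR T(2) by (intro hom_commute_if_commutator[OF Q(1)]) (auto simp: c_def)
    \<comment> \<open>An element commuting with \<open>a\<close> and \<open>b\<close> modulo
      \<open>T\<close> commutes with everything. This is applied to \<open>a\<close> and
      \<open>b\<close> themselves and afterwards, with the roles exchanged, to arbitrary
      elements.\<close>
    have qcomm: "q x \<otimes>\<^bsub>Q\<^esub> q y = q y \<otimes>\<^bsub>Q\<^esub> q x"
      if y: "y \<in> carrier G" and "q a \<otimes>\<^bsub>Q\<^esub> q y = q y \<otimes>\<^bsub>Q\<^esub> q a" "q b \<otimes>\<^bsub>Q\<^esub> q y = q y \<otimes>\<^bsub>Q\<^esub> q b"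
        and x: "x \<in> carrier G" for x y
    proof -
      from gen[OF x] obtain i j :: int and d where d: "d \<in> D" and x: "x = a [^] i \<otimes> b [^] j \<otimes> d" by blast
      have "d \<in> carrier G" using d by simp
      then show ?thesis unfolding x using that qd[OF d y]
        by (simp add: q.hom_int_pow q.H.commute_mult q.H.commute_int_pow)
    qed
    have qG: "q x \<otimes>\<^bsub>Q\<^esub> q y = q y \<otimes>\<^bsub>Q\<^esub> q x" if x: "x \<in> carrier G" and y: "y \<in> carrier G" for x y
    proof (rule qcomm[OF y _ _ x])
      show "q a \<otimes>\<^bsub>Q\<^esub> q y = q y \<otimes>\<^bsub>Q\<^esub> q a"
        by (rule qcomm[OF a _ _ y, symmetric]) (simp_all add: ba)
      show "q b \<otimes>\<^bsub>Q\<^esub> q y = q y \<otimes>\<^bsub>Q\<^esub> q b"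
        by (rule qcomm[OF b _ _ y, symmetric]) (simp_all add: ba)
    qed
    have "x \<in> T" if x: "x \<in> D" for x
      using q.derived_in_kernel[OF subset_refl qG x] Q(3)[OF D.mem_carrier[OF x]] by simp
    then show False using T(3) by blast
  qed
  then have "d \<in> R" using assms by blast
  then obtain k :: int where "h d = h c [^]\<^bsub>H\<^esub> k" "d \<in> carrier G" by (auto simp: R_def)
  then have "h (inv (c [^] k) \<otimes> d) = \<one>\<^bsub>H\<^esub>" by (simp add: h.hom_int_pow)
  then show ?thesis using ker[of "inv (c [^] k) \<otimes> d"] \<open>d \<in> carrier G\<close> by auto
qed

text \<open>If the squares of \<open>G'\<close> and the commutators \<open>[G, G']\<close> lie in \<open>E\<close>, then modulo \<open>E\<close> the
  commutator map is bilinear with values of order at most 2, so squares are central.\<close>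

lemma derived_M_subset:
  assumes E: "E \<lhd> G" and sq: "\<And>d. d \<in> D \<Longrightarrow> d \<otimes> d \<in> E"
    and comm: "\<And>d g. d \<in> D \<Longrightarrow> g \<in> carrier G \<Longrightarrow> g \<otimes> d \<otimes> inv g \<otimes> inv d \<in> E"
  shows "M' \<subseteq> E"
proof -
  interpret E: normal E G by fact
  obtain Q :: "'a set monoid" and q where Q: "group_hom G Q q" "q ` carrier G = carrier Q"
    "\<And>x. x \<in> carrier G \<Longrightarrow> q x = \<one>\<^bsub>Q\<^esub> \<longleftrightarrow> x \<in> E" "order Q * card E = order G"
    by (rule E.obtain_quotient_hom) (rule that)
  interpret q: group_hom G Q q by fact
  have qE: "q x = \<one>\<^bsub>Q\<^esub>" if "x \<in> E" for x
    using that Q(3) E.subset by blast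
  have qd: "q g \<otimes>\<^bsub>Q\<^esub> q d = q d \<otimes>\<^bsub>Q\<^esub> q g" if "d \<in> D" "g \<in> carrier G" for d g
    using that D.mem_carrier qE[OF comm] by (intro hom_commute_if_commutator[OF Q(1)]) auto
  let ?A = "q a" and ?B = "q b" and ?C = "q c"
  have CC: "?C \<otimes>\<^bsub>Q\<^esub> ?C = \<one>\<^bsub>Q\<^esub>" using qE[OF sq[OF c_in_D]] by simp
  \<comment> \<open>Moving \<open>a\<close> to the left past \<open>b\<close> costs a factor
    \<open>c\<close>. Moving it past \<open>b^2\<close> costs \<open>c^2\<close>, which vanishes
    because \<open>c\<close> is central of order at most 2 modulo \<open>E\<close>.\<close>
  have BA: "?B \<otimes>\<^bsub>Q\<^esub> ?A = ?C \<otimes>\<^bsub>Q\<^esub> (?A \<otimes>\<^bsub>Q\<^esub> ?B)"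
    by (simp add: c_def q.H.m_assoc)
  have "?B \<otimes>\<^bsub>Q\<^esub> ?B \<otimes>\<^bsub>Q\<^esub> ?A = ?B \<otimes>\<^bsub>Q\<^esub> ?C \<otimes>\<^bsub>Q\<^esub> (?A \<otimes>\<^bsub>Q\<^esub> ?B)"
    by (simp add: q.H.m_assoc BA)
  also have "\<dots> = ?C \<otimes>\<^bsub>Q\<^esub> (?B \<otimes>\<^bsub>Q\<^esub> ?A) \<otimes>\<^bsub>Q\<^esub> ?B"
    unfolding qd[OF c_in_D b] by (simp add: q.H.m_assoc)
  also have "\<dots> = (?C \<otimes>\<^bsub>Q\<^esub> ?C) \<otimes>\<^bsub>Q\<^esub> (?A \<otimes>\<^bsub>Q\<^esub> (?B \<otimes>\<^bsub>Q\<^esub> ?B))"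
    unfolding BA by (simp add: q.H.m_assoc)
  finally have BBA: "(?B \<otimes>\<^bsub>Q\<^esub> ?B) \<otimes>\<^bsub>Q\<^esub> ?A = ?A \<otimes>\<^bsub>Q\<^esub> (?B \<otimes>\<^bsub>Q\<^esub> ?B)"
    unfolding CC by simp
  have qcomm: "q x \<otimes>\<^bsub>Q\<^esub> q y = q y \<otimes>\<^bsub>Q\<^esub> q x"
    if y: "y \<in> carrier G" and ya: "?A \<otimes>\<^bsub>Q\<^esub> q y = q y \<otimes>\<^bsub>Q\<^esub> ?A"
      and yb: "(?B \<otimes>\<^bsub>Q\<^esub> ?B) \<otimes>\<^bsub>Q\<^esub> q y = q y \<otimes>\<^bsub>Q\<^esub> (?B \<otimes>\<^bsub>Q\<^esub> ?B)"
      and x: "x \<in> M" for x y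
  proof -
    from M_cases[OF x] obtain i j :: int and d where d: "d \<in> D" and x: "x = a [^] i \<otimes> b [^] (2 * j) \<otimes> d" .
    have "d \<in> carrier G" using d by simp
    have "b [^] (2 * j) = (b \<otimes> b) [^] j"
      using int_pow_mult[OF b, of 1 1] int_pow_pow[OF b, of 2 j] by simp
    then have qx: "q x = ?A [^]\<^bsub>Q\<^esub> i \<otimes>\<^bsub>Q\<^esub> (?B \<otimes>\<^bsub>Q\<^esub> ?B) [^]\<^bsub>Q\<^esub> j \<otimes>\<^bsub>Q\<^esub> q d"
      using \<open>d \<in> carrier G\<close> by (simp add: x q.hom_int_pow)
    show ?thesis unfolding qx using \<open>d \<in> carrier G\<close> y
      by (intro q.H.commute_mult q.H.commute_int_pow ya yb qd[OF d y, symmetric]) simp_all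
  qed
  have qM: "q x \<otimes>\<^bsub>Q\<^esub> q y = q y \<otimes>\<^bsub>Q\<^esub> q x" if x: "x \<in> M" and y: "y \<in> M" for x y
  proof (rule qcomm[OF _ _ _ x])
    have yG: "y \<in> carrier G" using y M_subset by blast
    show "y \<in> carrier G" by (rule yG)
    show "?A \<otimes>\<^bsub>Q\<^esub> q y = q y \<otimes>\<^bsub>Q\<^esub> ?A"
      by (rule qcomm[OF a _ _ y, symmetric]) (simp_all add: BBA)
    have "q y \<otimes>\<^bsub>Q\<^esub> q (b \<otimes> b) = q (b \<otimes> b) \<otimes>\<^bsub>Q\<^esub> q y"
      by (rule qcomm[OF _ _ _ y]) (simp_all add: BBA)
    then show "(?B \<otimes>\<^bsub>Q\<^esub> ?B) \<otimes>\<^bsub>Q\<^esub> q y = q y \<otimes>\<^bsub>Q\<^esub> (?B \<otimes>\<^bsub>Q\<^esub> ?B)" by simp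
  qed
  show ?thesis
  proof
    fix x assume x: "x \<in> M'"
    have "q x = \<one>\<^bsub>Q\<^esub>" by (rule q.derived_in_kernel[OF M_subset qM x])
    then show "x \<in> E" using Q(3)[OF M'.mem_carrier[OF x]] by simp
  qed
qed

text \<open>Modulo \<open>T\<close>, the squares of elements of \<open>G'\<close> form a normal subgroup \<open>E\<close> consisting of powers
  of \<open>x\<close>, and \<open>derived_M_subset\<close> applies to it.\<close>

lemma pow_square_subset:
  assumes T: "T \<lhd> G" and N: "N \<lhd> G" "N \<subseteq> M'" and x: "x \<in> carrier G"
    and central: "\<And>n g. n \<in> N \<Longrightarrow> g \<in> carrier G \<Longrightarrow> g \<otimes> n \<otimes> inv g \<otimes> inv n \<in> T"
    and sq: "\<And>n. n \<in> N \<Longrightarrow> n \<otimes> n \<in> T"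
    and even: "\<And>k::int. x [^] k \<in> D \<Longrightarrow> even k"
    and DN: "\<And>d. d \<in> D \<Longrightarrow> \<exists>k::int. inv (x [^] k) \<otimes> d \<in> N"
    and d: "d \<in> M'"
  shows "\<exists>k::int. inv (x [^] k) \<otimes> d \<in> T"
proof -
  interpret T: normal T G by fact
  interpret N: normal N G by fact
  obtain Q :: "'a set monoid" and q where Q: "group_hom G Q q" "q ` carrier G = carrier Q"
    "\<And>x. x \<in> carrier G \<Longrightarrow> q x = \<one>\<^bsub>Q\<^esub> \<longleftrightarrow> x \<in> T" "order Q * card T = order G"
    by (rule T.obtain_quotient_hom) (rule that)
  interpret q: group_hom G Q q by fact
  have qT: "q x = \<one>\<^bsub>Q\<^esub>" if "x \<in> T" for x
    using that Q(3) T.subset by blast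
  have qn: "q n \<otimes>\<^bsub>Q\<^esub> q g = q g \<otimes>\<^bsub>Q\<^esub> q n" if "n \<in> N" "g \<in> carrier G" for n g
    using that N.mem_carrier qT[OF central]
    by (intro hom_commute_if_commutator[OF Q(1), symmetric]) auto
  have D_form: "\<exists>(k::int) n. n \<in> N \<and> d = x [^] k \<otimes> n" if d: "d \<in> D" for d
  proof -
    from DN[OF d] obtain k :: int where "inv (x [^] k) \<otimes> d \<in> N" by blast
    then show ?thesis using x D.mem_carrier[OF d]
      by (intro exI[of _ k] exI[of _ "inv (x [^] k) \<otimes> d"]) simp
  qed
  have qx: "q x \<otimes>\<^bsub>Q\<^esub> q d = q d \<otimes>\<^bsub>Q\<^esub> q x" if d: "d \<in> D" for d
  proof -
    from D_form[OF d] obtain k :: int and n where n: "n \<in> N" and dk: "d = x [^] k \<otimes> n" by blast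
    have "q d \<otimes>\<^bsub>Q\<^esub> q x = q x \<otimes>\<^bsub>Q\<^esub> q d"
      unfolding dk using x n N.mem_carrier[OF n] qn[OF n x]
      by (simp add: q.hom_int_pow q.H.commute_mult q.H.commute_int_pow)
    then show ?thesis by simp
  qed
  \<comment> \<open>Modulo \<open>T\<close> the group \<open>G'\<close> is abelian: its elements are
    products of powers of \<open>x\<close>, which commute with \<open>G'\<close>, and of elements of
    the central \<open>N\<close>. Hence products of squares from \<open>G'\<close> are again
    squares, as the subgroup property of \<open>E\<close> requires.\<close>
  have qD: "q d \<otimes>\<^bsub>Q\<^esub> q e = q e \<otimes>\<^bsub>Q\<^esub> q d" if d: "d \<in> D" and e: "e \<in> D" for d e
  proof -
    from D_form[OF d] obtain k :: int and n where n: "n \<in> N" and dk: "d = x [^] k \<otimes> n" by blast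
    show ?thesis
      unfolding dk using x n N.mem_carrier[OF n] qn[OF n D.mem_carrier[OF e]] qx[OF e] D.mem_carrier[OF e]
      by (simp add: q.hom_int_pow q.H.commute_mult q.H.commute_int_pow)
  qed
  define E where "E = {e \<in> carrier G. \<exists>d\<in>D. q e = q d \<otimes>\<^bsub>Q\<^esub> q d}"
  have EI: "e \<in> E" if "e \<in> carrier G" "d \<in> D" "q e = q d \<otimes>\<^bsub>Q\<^esub> q d" for e d
    using that unfolding E_def by blast
  have "E \<lhd> G"
  proof (subst normal_inv_iff, intro conjI ballI)
    show "subgroup E G"
    proof
      show "\<one> \<in> E" by (rule EI[of _ \<one>]) (simp_all add: D.one_closed)
    next
      fix e1 e2 assume "e1 \<in> E" "e2 \<in> E"
      then obtain d1 d2 where e: "e1 \<in> carrier G" "e2 \<in> carrier G" "d1 \<in> D" "d2 \<in> D"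
        "q e1 = q d1 \<otimes>\<^bsub>Q\<^esub> q d1" "q e2 = q d2 \<otimes>\<^bsub>Q\<^esub> q d2" unfolding E_def by blast
      have cl: "q d1 \<in> carrier Q" "q d2 \<in> carrier Q" "d1 \<in> carrier G" "d2 \<in> carrier G" using e by simp_all
      have "q d1 \<otimes>\<^bsub>Q\<^esub> q d1 \<otimes>\<^bsub>Q\<^esub> (q d2 \<otimes>\<^bsub>Q\<^esub> q d2) = q d1 \<otimes>\<^bsub>Q\<^esub> (q d1 \<otimes>\<^bsub>Q\<^esub> q d2) \<otimes>\<^bsub>Q\<^esub> q d2"
        using cl by (simp add: q.H.m_assoc)
      also have "\<dots> = q d1 \<otimes>\<^bsub>Q\<^esub> (q d2 \<otimes>\<^bsub>Q\<^esub> q d1) \<otimes>\<^bsub>Q\<^esub> q d2"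
        by (simp only: qD[OF e(3,4)])
      also have "\<dots> = q d1 \<otimes>\<^bsub>Q\<^esub> q d2 \<otimes>\<^bsub>Q\<^esub> (q d1 \<otimes>\<^bsub>Q\<^esub> q d2)"
        using cl by (simp add: q.H.m_assoc)
      finally show "e1 \<otimes> e2 \<in> E" using e cl
        by (intro EI[of _ "d1 \<otimes> d2"]) simp_all
    next
      fix e assume "e \<in> E"
      then obtain d where "e \<in> carrier G" "d \<in> D" "q e = q d \<otimes>\<^bsub>Q\<^esub> q d" unfolding E_def by blast
      then show "inv e \<in> E"
        by (intro EI[of _ "inv d"]) (simp_all add: q.H.inv_mult_group)
    qed (auto simp: E_def)
    fix g e assume g: "g \<in> carrier G" and "e \<in> E"
    then obtain d where e: "e \<in> carrier G" "d \<in> D" "q e = q d \<otimes>\<^bsub>Q\<^esub> q d" unfolding E_def by blast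
    then show "g \<otimes> e \<otimes> inv g \<in> E"
      using g D.inv_op_closed2[OF g, of d]
      by (intro EI[of _ "g \<otimes> d \<otimes> inv g"]) (simp_all add: q.H.m_assoc)
  qed
  moreover have "d \<otimes> d \<in> E" if "d \<in> D" for d
    using that by (intro EI[of _ d]) simp_all
  moreover have "g \<otimes> d \<otimes> inv g \<otimes> inv d \<in> E" if d: "d \<in> D" and g: "g \<in> carrier G" for d g
  proof -
    from D_form[OF d] obtain k :: int and n where n: "n \<in> N" and dk: "d = x [^] k \<otimes> n" by blast
    have nG: "n \<in> carrier G" "d \<in> carrier G" using n d by simp_all
    \<comment> \<open>Since \<open>N\<close> lies in \<open>G'\<close>, the power \<open>x^k\<close>
      itself belongs to \<open>G'\<close>, so \<open>k\<close> is even and \<open>x^k\<close> has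
      the square root \<open>z\<close> among the powers of \<open>x\<close>.\<close>
    have "inv n \<in> D" using N(2) M'_subset_D N.m_inv_closed[OF n] by blast
    then have "d \<otimes> inv n \<in> D" using d by simp
    then have "x [^] k \<in> D" using dk x nG by (simp add: m_assoc)
    then obtain k' where k': "k = 2 * k'" using even by blast
    define z where "z = x [^] k'"
    have z: "z \<in> carrier G" "x [^] k = z \<otimes> z"
      using x int_pow_mult[OF x, of k' k'] by (simp_all add: z_def k')
    \<comment> \<open>The commutator \<open>w\<close> of \<open>g\<close> and \<open>z\<close> lies
      in \<open>G'\<close> and so commutes with \<open>z\<close> modulo \<open>T\<close>. Therefore
      \<open>[g, z^2] = (wz)^2 z^-2 = w^2\<close>, and the central factor \<open>n\<close>
      contributes nothing.\<close>
    define w where "w = g \<otimes> z \<otimes> inv g \<otimes> inv z"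
    have w: "w \<in> D" "w \<in> carrier G" using commutator_in_derived g z unfolding w_def by simp_all
    have gz: "q g \<otimes>\<^bsub>Q\<^esub> q z \<otimes>\<^bsub>Q\<^esub> inv\<^bsub>Q\<^esub> q g = q w \<otimes>\<^bsub>Q\<^esub> q z"
      using g z by (simp add: w_def q.H.m_assoc)
    have wz: "q z \<otimes>\<^bsub>Q\<^esub> q w = q w \<otimes>\<^bsub>Q\<^esub> q z"
      unfolding z_def using x qx[OF w(1)] w(2) by (simp add: q.hom_int_pow q.H.commute_int_pow)
    have gn: "q g \<otimes>\<^bsub>Q\<^esub> q n \<otimes>\<^bsub>Q\<^esub> inv\<^bsub>Q\<^esub> q g = q n"
      using qn[OF n g] g nG by (intro q.H.conj_commute) simp_all
    have "q (g \<otimes> d \<otimes> inv g \<otimes> inv d) =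
        (q g \<otimes>\<^bsub>Q\<^esub> q z \<otimes>\<^bsub>Q\<^esub> inv\<^bsub>Q\<^esub> q g) \<otimes>\<^bsub>Q\<^esub> (q g \<otimes>\<^bsub>Q\<^esub> q z \<otimes>\<^bsub>Q\<^esub> inv\<^bsub>Q\<^esub> q g)
        \<otimes>\<^bsub>Q\<^esub> (q g \<otimes>\<^bsub>Q\<^esub> q n \<otimes>\<^bsub>Q\<^esub> inv\<^bsub>Q\<^esub> q g) \<otimes>\<^bsub>Q\<^esub> inv\<^bsub>Q\<^esub> q n \<otimes>\<^bsub>Q\<^esub> inv\<^bsub>Q\<^esub> q z \<otimes>\<^bsub>Q\<^esub> inv\<^bsub>Q\<^esub> q z"
      unfolding dk z(2) using g z(1) nG by (simp add: q.H.m_assoc q.H.inv_mult_group inv_mult_group)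
    also have "\<dots> = q w \<otimes>\<^bsub>Q\<^esub> (q z \<otimes>\<^bsub>Q\<^esub> q w) \<otimes>\<^bsub>Q\<^esub> inv\<^bsub>Q\<^esub> q z"
      unfolding gz gn using z(1) w(2) nG by (simp add: q.H.m_assoc)
    also have "\<dots> = q w \<otimes>\<^bsub>Q\<^esub> q w"
      unfolding wz using z(1) w(2) by (simp add: q.H.m_assoc)
    finally show ?thesis using g nG w by (intro EI[of _ w]) simp_all
  qed
  ultimately have "M' \<subseteq> E" by (rule derived_M_subset)
  then obtain e where e: "d \<in> carrier G" "e \<in> D" "q d = q e \<otimes>\<^bsub>Q\<^esub> q e" using d unfolding E_def by blast
  from D_form[OF e(2)] obtain k :: int and n where n: "n \<in> N" and ek: "e = x [^] k \<otimes> n" by blast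
  have nG: "n \<in> carrier G" using n by simp
  \<comment> \<open>Modulo \<open>T\<close> the element \<open>n\<close> is central with trivial
    square, so \<open>(x^k n)^2\<close> reduces to \<open>x^(2k)\<close>.\<close>
  have "q d = q (x [^] k) \<otimes>\<^bsub>Q\<^esub> (q n \<otimes>\<^bsub>Q\<^esub> q (x [^] k)) \<otimes>\<^bsub>Q\<^esub> q n"
    unfolding e(3) ek using nG x by (simp add: q.H.m_assoc)
  also have "\<dots> = q (x [^] k) \<otimes>\<^bsub>Q\<^esub> q (x [^] k) \<otimes>\<^bsub>Q\<^esub> q (n \<otimes> n)"
    using qn[OF n, of "x [^] k"] nG x by (simp add: q.H.m_assoc)
  also have "\<dots> = q (x [^] (k + k))"
    using qT[OF sq[OF n]] x by (simp only: int_pow_mult) simp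
  finally have "q (inv (x [^] (k + k)) \<otimes> d) = \<one>\<^bsub>Q\<^esub>" using e(1) x by simp
  then have "inv (x [^] (k + k)) \<otimes> d \<in> T" using Q(3)[of "inv (x [^] (k + k)) \<otimes> d"] e(1) x by simp
  then show ?thesis by blast
qed

text \<open>A smallest normal subgroup \<open>N\<close> inside \<open>M'\<close> with
  \<open>G' \<subseteq> <x>N\<close> must be trivial. Otherwise \<open>chief_step\<close> gives
  \<open>T\<close> below \<open>N\<close>, and \<open>pow_square_subset\<close> places
  \<open>M'\<close>, hence also \<open>N\<close>, in \<open><x>T\<close>. Then
  \<open>G' \<subseteq> <x>T\<close>, against minimality.\<close>

lemma derived_cyclic:
  assumes x: "x \<in> carrier G"
    and even: "\<And>k::int. x [^] k \<in> D \<Longrightarrow> even k"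
    and DM: "\<And>d. d \<in> D \<Longrightarrow> \<exists>k::int. inv (x [^] k) \<otimes> d \<in> M'"
    and d: "d \<in> D"
  shows "\<exists>k::int. d = x [^] k"
proof -
  have fin: "finite (carrier G)"
    using ord by (metis order_gt_0_iff_finite pos2 zero_less_power)
  define NN where "NN = {N. N \<lhd> G \<and> N \<subseteq> M' \<and> (\<forall>d\<in>D. \<exists>k::int. inv (x [^] k) \<otimes> d \<in> N)}"
  have "M' \<in> NN" using M'.normal_axioms DM by (simp add: NN_def)
  then have "\<exists>N. N \<in> NN \<and> (\<forall>S. S \<in> NN \<longrightarrow> card N \<le> card S)"
    by (rule ex_has_least_nat)
  then obtain N where N: "N \<in> NN" and min: "\<And>S. S \<in> NN \<Longrightarrow> card N \<le> card S" by blast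
  have N': "N \<lhd> G" "N \<subseteq> M'" and DN: "\<And>d. d \<in> D \<Longrightarrow> \<exists>k::int. inv (x [^] k) \<otimes> d \<in> N"
    using N unfolding NN_def by blast+
  interpret N: normal N G by fact
  have "N = {\<one>}"
  proof (rule ccontr)
    assume "N \<noteq> {\<one>}"
    then have sub: "{\<one>} \<subset> N" using N.one_closed by blast
    obtain T where T: "T \<lhd> G" "{\<one>} \<subseteq> T" "T \<subset> N"
      "\<And>n g. n \<in> N \<Longrightarrow> g \<in> carrier G \<Longrightarrow> g \<otimes> n \<otimes> inv g \<otimes> inv n \<in> T"
      "\<And>n. n \<in> N \<Longrightarrow> n \<otimes> n \<in> T"
      by (rule chief_step[OF ord one_is_normal N'(1) sub]) (rule that)
    have NT: "\<exists>k::int. inv (x [^] k) \<otimes> m \<in> T" if "m \<in> M'" for m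
      by (rule pow_square_subset[OF T(1) N' x T(4,5) even DN that])
    have "\<exists>k::int. inv (x [^] k) \<otimes> d \<in> T" if d: "d \<in> D" for d
    proof -
      have dG: "d \<in> carrier G" using d by simp
      from DN[OF d] obtain k :: int where k: "inv (x [^] k) \<otimes> d \<in> N" by blast
      from k have "inv (x [^] k) \<otimes> d \<in> M'" using N'(2) by blast
      from NT[OF this] obtain l :: int where "inv (x [^] l) \<otimes> (inv (x [^] k) \<otimes> d) \<in> T" by blast
      also have "inv (x [^] l) \<otimes> (inv (x [^] k) \<otimes> d) = inv (x [^] (k + l)) \<otimes> d"
        using x dG by (simp add: int_pow_mult inv_mult_group m_assoc)
      finally show ?thesis by blast
    qed
    then have "T \<in> NN" using T(1,3) N'(2) unfolding NN_def by blast
    moreover have "card T < card N"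
      using T(3) finite_subset[OF N.subset fin] by (rule psubset_card_mono[rotated])
    ultimately show False using min by force
  qed
  with DN[OF d] obtain k :: int where "inv (x [^] k) \<otimes> d = \<one>" by blast
  then have "d = x [^] k" using x D.mem_carrier[OF d]
    by (metis int_pow_closed inv_closed inv_equality inv_inv)
  then show ?thesis by blast
qed

end

section \<open>Metacyclic groups as products of two cyclic subgroups\<close>

lemma (in group) metacyclicI:
  assumes x: "x \<in> carrier G" and y: "y \<in> carrier G"
    and der: "derived G (carrier G) \<subseteq> range (\<lambda>k::int. x [^] k)"
    and gen: "\<And>g. g \<in> carrier G \<Longrightarrow> \<exists>(i::int) (j::int). g = x [^] i \<otimes> y [^] j"
  shows "metacyclic G"
proof -
  let ?N = "range (\<lambda>k::int. x [^] k)"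
  have sub: "subgroup ?N G"
  proof
    fix u v assume "u \<in> ?N" "v \<in> ?N"
    then show "u \<otimes> v \<in> ?N" using x by (auto simp flip: int_pow_mult)
  next
    fix u assume "u \<in> ?N"
    then show "inv u \<in> ?N" using x by (auto simp flip: int_pow_neg)
  qed (use x int_pow_0[of G x] in \<open>auto intro: range_eqI[of _ _ "0::int"]\<close>)
  interpret N: subgroup ?N G by (rule sub)
  have normal: "?N \<lhd> G"
  proof (subst normal_inv_iff, intro conjI ballI sub)
    fix g u assume g: "g \<in> carrier G" and u: "u \<in> ?N"
    have uG: "u \<in> carrier G" using u N.mem_carrier by blast
    \<comment> \<open>A subgroup containing \<open>G'\<close> is normal, because a conjugate of
      \<open>u\<close> is \<open>[g, u] u\<close>.\<close>
    have "g \<otimes> u \<otimes> inv g \<otimes> inv u \<in> ?N"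
      using der commutator_in_derived[OF g uG] by blast
    then have "g \<otimes> u \<otimes> inv g \<otimes> inv u \<otimes> u \<in> ?N" using u by (rule N.m_closed)
    then show "g \<otimes> u \<otimes> inv g \<in> ?N" using g uG by (simp add: m_assoc)
  qed
  interpret N: normal ?N G by (rule normal)
  interpret H: group "G\<lparr>carrier := ?N\<rparr>" by (rule subgroup_imp_group[OF sub])
  have "x = x [^] (1::int)" using x by simp
  then have xN: "x \<in> ?N" by (rule range_eqI)
  have "cyclic_group (G\<lparr>carrier := ?N\<rparr>)"
    unfolding H.cyclic_group
  proof (rule bexI[of _ x])
    show "x \<in> carrier (G\<lparr>carrier := ?N\<rparr>)" using xN by simp
    show "carrier (G\<lparr>carrier := ?N\<rparr>) = range (\<lambda>n::int. x [^]\<^bsub>G\<lparr>carrier := ?N\<rparr>\<^esub> n)"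
      unfolding int_pow_consistent[OF sub xN, symmetric] by simp
  qed
  moreover have "cyclic_group (G Mod ?N)"
  proof (subst group.cyclic_group[OF N.factorgroup_is_group], intro bexI[of _ "?N #> y"])
    have "r_coset G ?N g \<in> range (\<lambda>k::int. (?N #> y) [^]\<^bsub>G Mod ?N\<^esub> k)" if g: "g \<in> carrier G" for g
    proof -
      from gen[OF g] obtain i j :: int where ij: "g = x [^] i \<otimes> y [^] j" by blast
      have "?N #> g = ?N #> x [^] i #> y [^] j"
        unfolding ij using x y N.subset by (subst coset_mult_assoc) auto
      also have "?N #> x [^] i = ?N" using x by (intro coset_join2 sub) auto
      finally show ?thesis using N.FactGroup_int_pow[OF y] by auto
    qed
    then show "carrier (G Mod ?N) = range (\<lambda>k::int. (?N #> y) [^]\<^bsub>G Mod ?N\<^esub> k)"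
      using y by (auto simp: carrier_FactGroup N.FactGroup_int_pow)
  qed (use y in \<open>simp add: carrier_FactGroup\<close>)
  ultimately show ?thesis using normal unfolding metacyclic_def by blast
qed

text \<open>\<open>y\<close> and \<open>x \<otimes> y\<close> lie in the same coset of
  \<open><x>\<close>, so either of them complements \<open>x\<close>. The second form serves the
  situation where neither \<open>x\<close> nor \<open>y\<close> belongs to the index 2 subgroup
  \<open>M\<close>; their product then does.\<close>

lemma (in group) metacyclicE:
  assumes "metacyclic G"
  obtains x y where "x \<in> carrier G" "y \<in> carrier G"
    "\<And>g. g \<in> carrier G \<Longrightarrow> \<exists>(i::int) (j::int). g = x [^] i \<otimes> y [^] j"
    "\<And>g. g \<in> carrier G \<Longrightarrow> \<exists>(i::int) (j::int). g = x [^] i \<otimes> (x \<otimes> y) [^] j"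
proof -
  obtain N where N: "N \<lhd> G" and cyc: "cyclic_group (G\<lparr>carrier := N\<rparr>)" "cyclic_group (G Mod N)"
    using assms unfolding metacyclic_def by blast
  interpret N: normal N G by fact
  interpret H: group "G\<lparr>carrier := N\<rparr>" by (rule subgroup_imp_group[OF N.is_subgroup])
  obtain x where x: "x \<in> N" "N = range (\<lambda>k::int. x [^] k)"
  proof -
    have "\<exists>x\<in>N. N = range (\<lambda>k::int. x [^]\<^bsub>G\<lparr>carrier := N\<rparr>\<^esub> k)"
      using cyc(1) unfolding H.cyclic_group by simp
    then obtain x where x: "x \<in> N" "N = range (\<lambda>k::int. x [^]\<^bsub>G\<lparr>carrier := N\<rparr>\<^esub> k)"
      by metis
    from x(2) have "N = range (\<lambda>k::int. x [^] k)"
      unfolding int_pow_consistent[OF N.is_subgroup x(1), symmetric] .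
    then show thesis by (rule that[OF x(1)])
  qed
  obtain y where y: "y \<in> carrier G" "carrier (G Mod N) = range (\<lambda>k::int. (N #> y) [^]\<^bsub>G Mod N\<^esub> k)"
    using cyc(2) unfolding group.cyclic_group[OF N.factorgroup_is_group] by (auto simp: carrier_FactGroup)
  have gen: "\<exists>(i::int) (j::int). g = x [^] i \<otimes> z [^] j"
    if z: "z \<in> carrier G" "N #> z = N #> y" and g: "g \<in> carrier G" for z g
  proof -
    have "N #> g \<in> range (\<lambda>k::int. (N #> y) [^]\<^bsub>G Mod N\<^esub> k)"
      using g unfolding y(2)[symmetric] by (simp add: carrier_FactGroup)
    then obtain j :: int where "N #> g = N #> z [^] j"
      unfolding z(2)[symmetric] N.FactGroup_int_pow[OF z(1)] by blast
    then have "g \<in> N #> z [^] j" using rcos_self[OF g N.is_subgroup] by simp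
    then obtain u where "u \<in> N" "g = u \<otimes> z [^] j" by (auto simp: r_coset_def)
    then show ?thesis using x(2) by blast
  qed
  have xy: "N #> (x \<otimes> y) = N #> y"
    using coset_mult_assoc[OF N.subset N.mem_carrier[OF x(1)] y(1)] x(1) N.mem_carrier[OF x(1)]
      coset_join2[OF _ N.is_subgroup x(1)] by simp
  show thesis
  proof (rule that)
    show "x \<in> carrier G" "y \<in> carrier G" using x(1) y(1) by simp_all
    show "\<exists>(i::int) (j::int). g = x [^] i \<otimes> y [^] j" if "g \<in> carrier G" for g
      by (rule gen[OF y(1) refl that])
    show "\<exists>(i::int) (j::int). g = x [^] i \<otimes> (x \<otimes> y) [^] j" if "g \<in> carrier G" for g
      using x(1) y(1) by (intro gen[OF _ xy that]) simp
  qed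
qed

section \<open>The two possibilities for M/M'\<close>

context two_four_group
begin

text \<open>Describes the natural map from \<open>M\<close> onto \<open>M/M'\<close> by the
  operations of \<open>G\<close> itself, so that later computations stay out of the restricted group
  \<open>G\<lparr>carrier := M\<rparr>\<close>.\<close>

lemma obtain_abelianization:
  obtains A :: "'a set monoid" and F where "A = abelianization (G\<lparr>carrier := M\<rparr>)"
    "comm_group A" "\<exists>l. order A = 2 ^ l"
    "\<And>x. x \<in> M \<Longrightarrow> F x \<in> carrier A"
    "\<And>x y. x \<in> M \<Longrightarrow> y \<in> M \<Longrightarrow> F (x \<otimes> y) = F x \<otimes>\<^bsub>A\<^esub> F y"
    "\<And>x k. x \<in> M \<Longrightarrow> F (x [^] (k::int)) = F x [^]\<^bsub>A\<^esub> k"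
    "\<And>x y. x \<in> M \<Longrightarrow> y \<in> M \<Longrightarrow> F x = F y \<longleftrightarrow> inv x \<otimes> y \<in> M'"
    "\<And>z. z \<in> carrier A \<Longrightarrow> \<exists>x\<in>M. z = F x"
proof -
  define H where "H = G\<lparr>carrier := M\<rparr>"
  define A where "A = abelianization H"
  define F where "F = (\<lambda>x. derived H (carrier H) #>\<^bsub>H\<^esub> x)"
  interpret H: group H unfolding H_def by (rule subgroup_imp_group[OF M.is_subgroup])
  interpret N: normal "derived H (carrier H)" H by (rule H.derived_self_is_normal)
  have M: "carrier H = M" "\<And>x y. x \<otimes>\<^bsub>H\<^esub> y = x \<otimes> y" by (simp_all add: H_def)
  have der: "derived H (carrier H) = M'"
    using derived_consistent[OF subset_refl M.is_subgroup] by (simp add: H_def)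
  interpret F: group_hom H A F
    unfolding A_def F_def by (rule N.quotient_hom(1))
  have ker: "F x = \<one>\<^bsub>A\<^esub> \<longleftrightarrow> x \<in> M'" if "x \<in> M" for x
  proof -
    have "F x = \<one>\<^bsub>A\<^esub> \<longleftrightarrow> x \<in> derived H (carrier H)"
      unfolding A_def F_def by (rule N.quotient_hom(3)) (simp add: M that)
    then show ?thesis by (simp only: der)
  qed
  have inv: "inv\<^bsub>H\<^esub> x = inv x" if "x \<in> M" for x
    using m_inv_consistent[OF M.is_subgroup that] by (simp add: H_def)
  show thesis
  proof
    show "A = abelianization (G\<lparr>carrier := M\<rparr>)" by (simp add: A_def H_def)
    show "comm_group A" unfolding A_def by (rule H.derived_quot_is_comm_group)
    have "order A dvd order H"
      using N.quotient_hom(4) unfolding A_def by (metis dvd_triv_left)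
    moreover have "order H dvd 2 ^ n"
      using lagrange[OF M.is_subgroup] ord by (metis H_def dvd_triv_right order_def partial_object.simps(1) M(1))
    ultimately show "\<exists>l. order A = 2 ^ l"
      using divides_primepow_nat two_is_prime_nat dvd_trans by blast
    show "F x \<in> carrier A" if "x \<in> M" for x
      using F.hom_closed that by (simp add: M)
    show mult: "F (x \<otimes> y) = F x \<otimes>\<^bsub>A\<^esub> F y" if "x \<in> M" "y \<in> M" for x y
      using F.hom_mult that by (simp add: M)
    show "F (x [^] (k::int)) = F x [^]\<^bsub>A\<^esub> k" if "x \<in> M" for x k
      using F.hom_int_pow that int_pow_consistent[OF M.is_subgroup that, of k] by (simp add: M(1) H_def[symmetric])
    show "F x = F y \<longleftrightarrow> inv x \<otimes> y \<in> M'" if xy: "x \<in> M" "y \<in> M" for x y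
    proof -
      have cl: "F x \<in> carrier A" "F y \<in> carrier A" using F.hom_closed xy by (simp_all add: M)
      have "F (inv x \<otimes> y) = inv\<^bsub>A\<^esub> F x \<otimes>\<^bsub>A\<^esub> F y"
        using mult[OF M.m_inv_closed[OF xy(1)] xy(2)] F.hom_inv xy by (simp add: M inv[symmetric])
      then show ?thesis
        using ker[of "inv x \<otimes> y"] xy cl F.H.inv_solve_left'[of "\<one>\<^bsub>A\<^esub>" "F x" "F y"] by auto
    qed
    show "\<exists>x\<in>M. z = F x" if "z \<in> carrier A" for z
    proof -
      have "z \<in> F ` carrier H" using that N.quotient_hom(2) unfolding A_def F_def by simp
      then show ?thesis by (auto simp: M)
    qed
  qed
qed

text \<open>Modulo \<open>M'\<close>, conjugation by \<open>b\<close> sends \<open>a\<close> to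
  \<open>ca\<close>, hence \<open>a^2\<close> to \<open>(ca)^2 = c^2 a^2 = c^(r+2)\<close>. It also
  inverts \<open>c\<close>, so it sends \<open>a^2 = c^r\<close> to \<open>c^(-r)\<close>. Comparing
  the two values gives the relation.\<close>

lemma c_relation:
  assumes "inv (c [^] (r::int)) \<otimes> (a \<otimes> a) \<in> M'"
  shows "c [^] (2 * (r + 1)) \<in> M'"
proof -
  obtain H :: "'a set monoid" and h where hom: "group_hom G H h" and surj: "h ` carrier G = carrier H"
    and ker: "\<And>x. x \<in> carrier G \<Longrightarrow> h x = \<one>\<^bsub>H\<^esub> \<longleftrightarrow> x \<in> M'" and "order H * card M' = order G"
    by (rule M'.obtain_quotient_hom) (rule that)
  interpret h: group_hom G H h by fact
  have hM': "h x = \<one>\<^bsub>H\<^esub>" if "x \<in> M'" for x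
    using ker[OF M'.mem_carrier[OF that]] that by simp
  let ?A = "h a" and ?B = "h b" and ?C = "h c"
  have "inv\<^bsub>H\<^esub> (?C [^]\<^bsub>H\<^esub> r) \<otimes>\<^bsub>H\<^esub> (?A \<otimes>\<^bsub>H\<^esub> ?A) = \<one>\<^bsub>H\<^esub>"
    using hM'[OF assms] by (simp add: h.hom_int_pow)
  then have AA: "?A \<otimes>\<^bsub>H\<^esub> ?A = ?C [^]\<^bsub>H\<^esub> r"
    using h.H.inv_solve_left'[of "\<one>\<^bsub>H\<^esub>" "?C [^]\<^bsub>H\<^esub> r" "?A \<otimes>\<^bsub>H\<^esub> ?A"] by simp
  have CA: "?A \<otimes>\<^bsub>H\<^esub> ?C = ?C \<otimes>\<^bsub>H\<^esub> ?A"
    using c_in_D derived_subset_M by (intro hom_commute_on_M[OF hom hM']) auto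
  have BAB: "?B \<otimes>\<^bsub>H\<^esub> ?A \<otimes>\<^bsub>H\<^esub> inv\<^bsub>H\<^esub> ?B = ?C \<otimes>\<^bsub>H\<^esub> ?A"
    by (simp add: c_def h.H.m_assoc)
  have "?B \<otimes>\<^bsub>H\<^esub> (?C [^]\<^bsub>H\<^esub> r) \<otimes>\<^bsub>H\<^esub> inv\<^bsub>H\<^esub> ?B = ?C [^]\<^bsub>H\<^esub> (- r)"
    using h.H.conj_int_pow[of ?B ?C r] conj_b_c[OF hom hM'] by (simp add: h.H.int_pow_inv h.H.int_pow_neg)
  moreover have "?B \<otimes>\<^bsub>H\<^esub> (?A \<otimes>\<^bsub>H\<^esub> ?A) \<otimes>\<^bsub>H\<^esub> inv\<^bsub>H\<^esub> ?B = ?C [^]\<^bsub>H\<^esub> (2 + r)"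
  proof -
    have "?B \<otimes>\<^bsub>H\<^esub> (?A \<otimes>\<^bsub>H\<^esub> ?A) \<otimes>\<^bsub>H\<^esub> inv\<^bsub>H\<^esub> ?B =
        (?B \<otimes>\<^bsub>H\<^esub> ?A \<otimes>\<^bsub>H\<^esub> inv\<^bsub>H\<^esub> ?B) \<otimes>\<^bsub>H\<^esub> (?B \<otimes>\<^bsub>H\<^esub> ?A \<otimes>\<^bsub>H\<^esub> inv\<^bsub>H\<^esub> ?B)"
      by (simp add: h.H.m_assoc)
    also have "\<dots> = ?C \<otimes>\<^bsub>H\<^esub> (?A \<otimes>\<^bsub>H\<^esub> ?C) \<otimes>\<^bsub>H\<^esub> ?A"
      unfolding BAB by (simp add: h.H.m_assoc)
    also have "\<dots> = (?C \<otimes>\<^bsub>H\<^esub> ?C) \<otimes>\<^bsub>H\<^esub> (?A \<otimes>\<^bsub>H\<^esub> ?A)"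
      unfolding CA by (simp add: h.H.m_assoc)
    also have "\<dots> = ?C [^]\<^bsub>H\<^esub> (2 + r)"
      unfolding AA using h.H.int_pow_mult[of ?C 1 1] by (simp add: h.H.int_pow_mult)
    finally show ?thesis .
  qed
  ultimately have eq: "?C [^]\<^bsub>H\<^esub> (2 + r) = ?C [^]\<^bsub>H\<^esub> (- r)" unfolding AA by simp
  have "?C [^]\<^bsub>H\<^esub> (2 * (r + 1)) = ?C [^]\<^bsub>H\<^esub> (2 + r + r)" by (simp add: algebra_simps)
  also have "\<dots> = ?C [^]\<^bsub>H\<^esub> (- r) \<otimes>\<^bsub>H\<^esub> ?C [^]\<^bsub>H\<^esub> r"
    unfolding eq[symmetric] by (rule h.H.int_pow_mult) simp
  also have "\<dots> = \<one>\<^bsub>H\<^esub>" by (simp add: h.H.int_pow_neg)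
  finally have "h (c [^] (2 * (r + 1))) = \<one>\<^bsub>H\<^esub>" by (simp add: h.hom_int_pow)
  then show ?thesis by (simp add: ker)
qed

text \<open>With the factor from \<open>G'\<close> in front, a leading power of \<open>x\<close> can
  absorb it once \<open>G'\<close> consists of powers of \<open>x\<close>. Both orders of the
  generators are provided because \<open>x\<close> may be \<open>a\<close> or
  \<open>b\<close>.\<close>

lemma gen_left:
  assumes "x \<in> carrier G"
  shows "\<exists>d\<in>D. \<exists>(i::int) (j::int). x = d \<otimes> a [^] i \<otimes> b [^] j"
    and "\<exists>d\<in>D. \<exists>(i::int) (j::int). x = d \<otimes> b [^] j \<otimes> a [^] i"
proof -
  from gen[OF assms] obtain i j :: int and d where d: "d \<in> D" and x: "x = a [^] i \<otimes> b [^] j \<otimes> d" by blast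
  have dG: "d \<in> carrier G" using d by simp
  define g where "g = a [^] i \<otimes> b [^] j"
  have g: "g \<in> carrier G" by (simp add: g_def)
  define e where "e = g \<otimes> d \<otimes> inv g"
  have e: "e \<in> D" unfolding e_def by (rule D.inv_op_closed2[OF g d])
  then have eG: "e \<in> carrier G" by simp
  have xe: "x = e \<otimes> g" using g dG by (simp add: x g_def[symmetric] e_def m_assoc)
  then have "x = e \<otimes> a [^] i \<otimes> b [^] j" using eG by (simp add: g_def m_assoc)
  then show "\<exists>d\<in>D. \<exists>(i::int) (j::int). x = d \<otimes> a [^] i \<otimes> b [^] j" using e by blast
  define f where "f = a [^] i \<otimes> b [^] j \<otimes> inv (a [^] i) \<otimes> inv (b [^] j)"
  have f: "f \<in> D" "f \<in> carrier G" unfolding f_def by (simp_all add: commutator_in_derived)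
  have "g = f \<otimes> b [^] j \<otimes> a [^] i" by (simp add: g_def f_def m_assoc)
  then have "x = (e \<otimes> f) \<otimes> b [^] j \<otimes> a [^] i" using xe eG f by (simp add: m_assoc)
  moreover have "e \<otimes> f \<in> D" using e f by simp
  ultimately show "\<exists>d\<in>D. \<exists>(i::int) (j::int). x = d \<otimes> b [^] j \<otimes> a [^] i" by blast
qed

text \<open>The parity condition of \<open>derived_cyclic\<close> holds for both generators, whose
  orders modulo \<open>G'\<close> are 2 and 4.\<close>

lemma metacyclic_if_derived_cyclic:
  assumes "x = a \<and> y = b \<or> x = b \<and> y = a"
    and DM: "\<And>d. d \<in> D \<Longrightarrow> \<exists>k::int. inv (x [^] k) \<otimes> d \<in> M'"
  shows "metacyclic G"
proof -
  have cl: "x \<in> carrier G" "y \<in> carrier G" using assms(1) by auto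
  have even: "even k" if "x [^] k \<in> D" for k :: int
    using assms(1) that indep[of k 0] indep[of 0 k] by auto
  have D: "\<exists>k::int. d = x [^] k" if "d \<in> D" for d
    by (rule derived_cyclic[OF cl(1) even DM that])
  show ?thesis
  proof (rule metacyclicI[OF cl])
    show "D \<subseteq> range (\<lambda>k::int. x [^] k)" using D by blast
    fix g assume g: "g \<in> carrier G"
    have "\<exists>d\<in>D. \<exists>(i::int) (j::int). g = d \<otimes> x [^] i \<otimes> y [^] j"
      using assms(1) gen_left[OF g] by blast
    then obtain d and i j :: int where d: "d \<in> D" "g = d \<otimes> x [^] i \<otimes> y [^] j" by blast
    from D[OF d(1)] obtain k :: int where "d = x [^] k" by blast
    then have "g = x [^] (k + i) \<otimes> y [^] j" using cl d(2) by (simp add: int_pow_mult)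
    then show "\<exists>(i::int) (j::int). g = x [^] i \<otimes> y [^] j" by blast
  qed
qed

text \<open>Applies \<open>abelian_type_cases\<close> to \<open>M/M'\<close>. The exponent 2 is
  recorded in the elementary alternative for the later count of generators.\<close>

lemma M_dichotomy:
  fixes A :: "'a set monoid"
  assumes A: "A = abelianization (G\<lparr>carrier := M\<rparr>)"
  shows "has_abelian_type A [2, 2, 2] \<and> (\<forall>x\<in>carrier A. x \<otimes>\<^bsub>A\<^esub> x = \<one>\<^bsub>A\<^esub>) \<or>
    (\<exists>m\<ge>1. has_abelian_type A [2, 2 ^ m]) \<and> metacyclic G"
proof -
  obtain A' :: "'a set monoid" and F where A': "A' = abelianization (G\<lparr>carrier := M\<rparr>)"
    and comm: "comm_group A'" and ordA: "\<exists>l. order A' = 2 ^ l"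
    and F_closed: "\<And>x. x \<in> M \<Longrightarrow> F x \<in> carrier A'"
    and F_mult: "\<And>x y. x \<in> M \<Longrightarrow> y \<in> M \<Longrightarrow> F (x \<otimes> y) = F x \<otimes>\<^bsub>A'\<^esub> F y"
    and F_pow: "\<And>x k. x \<in> M \<Longrightarrow> F (x [^] (k::int)) = F x [^]\<^bsub>A'\<^esub> k"
    and F_eq: "\<And>x y. x \<in> M \<Longrightarrow> y \<in> M \<Longrightarrow> F x = F y \<longleftrightarrow> inv x \<otimes> y \<in> M'"
    and F_surj: "\<And>z. z \<in> carrier A' \<Longrightarrow> \<exists>x\<in>M. z = F x"
    by (rule obtain_abelianization) (rule that)
  have AA: "A' = A" using A A' by simp
  interpret A: comm_group A using comm AA by simp
  note F = F_closed[unfolded AA] F_mult[unfolded AA] F_pow[unfolded AA]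
  obtain l where l: "order A = 2 ^ l" using ordA AA by blast
  have M: "c \<in> M" "a \<in> M" "b \<otimes> b \<in> M" using c_in_D derived_subset_M by auto
  have M_pow: "x [^] (k::int) \<in> M" if "x \<in> M" for x k
    using subgroup_int_pow_closed[OF M.is_subgroup that] .
  have sq: "x [^] (2::int) = x \<otimes> x" if "x \<in> carrier G" for x
    using int_pow_mult[OF that, of 1 1] that by simp
  have D_pow: "\<exists>k::int. F d = F (c [^] k)" if d: "d \<in> D" for d
  proof -
    have "d \<in> M" using d derived_subset_M by blast
    moreover from derived_subset_pow_c[OF d] obtain k :: int where "inv (c [^] k) \<otimes> d \<in> M'" by blast
    ultimately show ?thesis using F_eq[OF M_pow[OF M(1)]] by metis
  qed
  have F_one: "F x = \<one>\<^bsub>A\<^esub> \<longleftrightarrow> x \<in> M'" if "x \<in> M" for x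
    using F_eq[OF M.one_closed that] F_pow[OF M.one_closed, of 0] that by (auto simp: AA)
  have "a \<otimes> a \<in> D" "(b \<otimes> b) \<otimes> (b \<otimes> b) \<in> D" using M(2,3) unfolding M_def by blast+
  then obtain s :: int and r :: int where r: "inv (c [^] r) \<otimes> (a \<otimes> a) \<in> M'"
    and s: "inv (c [^] s) \<otimes> ((b \<otimes> b) \<otimes> (b \<otimes> b)) \<in> M'"
    using derived_subset_pow_c by metis
  have "(has_abelian_type A [2, 2, 2] \<and> (\<forall>x\<in>carrier A. x \<otimes>\<^bsub>A\<^esub> x = \<one>\<^bsub>A\<^esub>)) \<or>
    (\<exists>m\<ge>1. has_abelian_type A [2, 2 ^ m]) \<and>
      ((\<exists>l::int. F c = F a [^]\<^bsub>A\<^esub> l) \<or> (\<exists>l::int. F c = F (b \<otimes> b) [^]\<^bsub>A\<^esub> l))"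
  proof (rule A.abelian_type_cases[OF l])
    show "F a \<in> carrier A" "F (b \<otimes> b) \<in> carrier A" "F c \<in> carrier A" using F(1) M by auto
    show "\<exists>(i::int) (j::int) (k::int). z = F a [^]\<^bsub>A\<^esub> i \<otimes>\<^bsub>A\<^esub> F (b \<otimes> b) [^]\<^bsub>A\<^esub> j \<otimes>\<^bsub>A\<^esub> F c [^]\<^bsub>A\<^esub> k"
      if z: "z \<in> carrier A" for z
    proof -
      obtain x where x: "x \<in> M" "z = F x" using F_surj z AA by blast
      obtain i j :: int and d where d: "d \<in> D" "x = a [^] i \<otimes> b [^] (2 * j) \<otimes> d"
        using M_cases[OF x(1)] .
      from D_pow[OF d(1)] obtain k :: int where k: "F d = F (c [^] k)" by blast
      have "b [^] (2 * j) = (b \<otimes> b) [^] j" using int_pow_pow[OF b, of 2 j] by (simp add: sq)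
      moreover have "d \<in> M" using d derived_subset_M by blast
      ultimately have "z = F (a [^] i) \<otimes>\<^bsub>A\<^esub> F ((b \<otimes> b) [^] j) \<otimes>\<^bsub>A\<^esub> F (c [^] k)"
        unfolding x(2) d(2) using M M_pow by (simp add: F(2) k M.m_closed)
      then show ?thesis using F(3) M by auto
    qed
    show "even i \<and> even j"
      if *: "F a [^]\<^bsub>A\<^esub> i \<otimes>\<^bsub>A\<^esub> F (b \<otimes> b) [^]\<^bsub>A\<^esub> j \<otimes>\<^bsub>A\<^esub> F c [^]\<^bsub>A\<^esub> k = \<one>\<^bsub>A\<^esub>" for i j k :: int
    proof -
      have "F (a [^] i \<otimes> (b \<otimes> b) [^] j \<otimes> c [^] k) = \<one>\<^bsub>A\<^esub>"
        using * M M_pow by (simp add: F M.m_closed)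
      moreover have "a [^] i \<otimes> (b \<otimes> b) [^] j \<otimes> c [^] k \<in> M"
        using M M_pow by (simp add: M.m_closed)
      ultimately have "a [^] i \<otimes> (b \<otimes> b) [^] j \<otimes> c [^] k \<in> D"
        using F_one M'_subset_D by blast
      moreover have "(b \<otimes> b) [^] j = b [^] (2 * j)" using int_pow_pow[OF b, of 2 j] by (simp add: sq)
      moreover have "c [^] k \<in> D" by (rule subgroup_int_pow_closed[OF D.is_subgroup c_in_D])
      \<comment> \<open>The exponent of \<open>b\<close> is \<open>2 * j\<close>, so divisibility by
        4 amounts to \<open>j\<close> being even.\<close>
      ultimately show ?thesis using in_derived_iff(1)[of "c [^] k" i "2 * j"] by simp presburger
    qed
    have "F (c [^] r) = F (a \<otimes> a)" using F_eq[OF M_pow[OF M(1)] M.m_closed[OF M(2,2)]] r by blast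
    then show "F a [^]\<^bsub>A\<^esub> (2::int) = F c [^]\<^bsub>A\<^esub> r"
      using F(3)[OF M(2), of 2] F(3)[OF M(1), of r] by (simp add: sq)
    have "F (c [^] s) = F ((b \<otimes> b) \<otimes> (b \<otimes> b))"
      using F_eq[OF M_pow[OF M(1)] M.m_closed[OF M(3,3)]] s by blast
    then show "F (b \<otimes> b) [^]\<^bsub>A\<^esub> (2::int) = F c [^]\<^bsub>A\<^esub> s"
      using F(3)[OF M(3), of 2] F(3)[OF M(1), of s] by (simp add: sq)
    show "F c [^]\<^bsub>A\<^esub> (2 * (r + 1)) = \<one>\<^bsub>A\<^esub>"
      using c_relation[OF r] F_one[OF M_pow[OF M(1)]] F(3)[OF M(1)] by metis
  qed
  moreover have "metacyclic G"
    if "(\<exists>l::int. F c = F a [^]\<^bsub>A\<^esub> l) \<or> (\<exists>l::int. F c = F (b \<otimes> b) [^]\<^bsub>A\<^esub> l)"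
  proof -
    \<comment> \<open>A power of \<open>b^2\<close> is an even power of \<open>b\<close>, so
      \<open>x = b\<close> serves in the second case. Membership of the power in \<open>M\<close> is
      carried along because \<open>b\<close> itself lies outside \<open>M\<close>, where nothing is
      known about \<open>F\<close>.\<close>
    have "\<exists>x y. (x = a \<and> y = b \<or> x = b \<and> y = a) \<and> (\<exists>l::int. x [^] l \<in> M \<and> F c = F (x [^] l))"
      using that
    proof
      assume "\<exists>l::int. F c = F a [^]\<^bsub>A\<^esub> l"
      then show ?thesis using F(3)[OF M(2)] M_pow[OF M(2)] by metis
    next
      assume "\<exists>l::int. F c = F (b \<otimes> b) [^]\<^bsub>A\<^esub> l"
      then obtain l :: int where "F c = F ((b \<otimes> b) [^] l)" using F(3)[OF M(3)] by metis
      moreover have "(b \<otimes> b) [^] l = b [^] (2 * l)" using int_pow_pow[OF b, of 2 l] by (simp add: sq)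
      ultimately show ?thesis using M_pow[OF M(3), of l] by metis
    qed
    then obtain x y and l :: int where xy: "x = a \<and> y = b \<or> x = b \<and> y = a"
      and xl: "x [^] l \<in> M" "F c = F (x [^] l)" by blast
    have x: "x \<in> carrier G" using xy by auto
    show "metacyclic G"
    proof (rule metacyclic_if_derived_cyclic[OF xy])
      fix d assume d: "d \<in> D"
      then have dM: "d \<in> M" using derived_subset_M by blast
      from D_pow[OF d] obtain k :: int where "F d = F (c [^] k)" by blast
      also have "\<dots> = F ((x [^] l) [^] k)" using F(3)[OF M(1)] F(3)[OF xl(1)] xl(2) by simp
      also have "(x [^] l) [^] k = x [^] (l * k)" using x by (rule int_pow_pow)
      finally have "F (x [^] (l * k)) = F d" by simp
      moreover have "x [^] (l * k) \<in> M" using M_pow[OF xl(1), of k] x by (simp add: int_pow_pow)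
      ultimately have "inv (x [^] (l * k)) \<otimes> d \<in> M'" using F_eq dM by blast
      then show "\<exists>k::int. inv (x [^] k) \<otimes> d \<in> M'" by blast
    qed
  qed
  ultimately show ?thesis by blast
qed

section \<open>The number of generators of M\<close>

lemma pow_in_M:
  assumes z: "z \<in> carrier G" and k: "z [^] (k::int) \<in> M"
  shows "z \<in> M \<or> (\<exists>l::int. z [^] k = (z \<otimes> z) [^] l)"
proof (cases "z \<in> M")
  case False
  have zz: "z \<otimes> z \<in> M" by (rule M_mult[OF z False z False])
  have pow: "z [^] (2 * l) = (z \<otimes> z) [^] l" for l :: int
    using int_pow_pow[OF z, of 2 l] int_pow_mult[OF z, of 1 1] z by simp
  have "even k"
  proof (rule ccontr)
    assume "odd k"
    then obtain l where l: "k = 2 * l + 1" by (elim oddE)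
    have m: "z [^] (2 * l) \<in> M" unfolding pow by (rule subgroup_int_pow_closed[OF M.is_subgroup zz])
    have "inv (z [^] (2 * l)) \<otimes> z [^] k \<in> M"
      by (intro M.m_closed M.m_inv_closed m k)
    then show False using False z by (simp add: l int_pow_mult)
  qed
  then show ?thesis using pow by (elim evenE) blast
qed simp

text \<open>As \<open>M\<close> has index 2, it contains one of \<open>x\<close>, \<open>y\<close>
  and \<open>xy\<close>. If \<open>x\<close> lies in \<open>M\<close>, then \<open>y\<close> does
  not, and \<open>M = <x><y^2>\<close>. Otherwise some \<open>z\<close> among \<open>y\<close> and
  \<open>xy\<close> lies in \<open>M\<close>, and \<open>M = <x^2><z>\<close>.\<close>

lemma M_two_generated:
  assumes "metacyclic G"
  shows "\<exists>u\<in>M. \<exists>v\<in>M. \<forall>m\<in>M. \<exists>(i::int) (j::int). m = u [^] i \<otimes> v [^] j"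
proof -
  obtain x y where x: "x \<in> carrier G" and y: "y \<in> carrier G"
    and gen_y: "\<And>g. g \<in> carrier G \<Longrightarrow> \<exists>(i::int) (j::int). g = x [^] i \<otimes> y [^] j"
    and gen_xy: "\<And>g. g \<in> carrier G \<Longrightarrow> \<exists>(i::int) (j::int). g = x [^] i \<otimes> (x \<otimes> y) [^] j"
    by (rule metacyclicE[OF assms]) (rule that)
  note Mpow = subgroup_int_pow_closed[OF M.is_subgroup]
  have left: ?thesis if xM: "x \<notin> M" and z: "z \<in> M"
    and gen_z: "\<And>g. g \<in> carrier G \<Longrightarrow> \<exists>(i::int) (j::int). g = x [^] i \<otimes> z [^] j" for z
  proof (rule bexI[of _ "x \<otimes> x"], rule bexI[of _ z], rule ballI)
    show "z \<in> M" "x \<otimes> x \<in> M" by (rule z, rule M_mult[OF x xM x xM])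
    fix m assume m: "m \<in> M"
    obtain i j :: int where ij: "m = x [^] i \<otimes> z [^] j" using gen_z[OF M.mem_carrier[OF m]] by blast
    have "m \<otimes> inv (z [^] j) \<in> M" using m Mpow[OF z] by (intro M.m_closed M.m_inv_closed)
    then have "x [^] i \<in> M" using ij x M.mem_carrier[OF z] by (simp add: m_assoc)
    then obtain l :: int where "x [^] i = (x \<otimes> x) [^] l" using pow_in_M[OF x] xM by blast
    with ij have "m = (x \<otimes> x) [^] l \<otimes> z [^] j" by simp
    then show "\<exists>(i::int) (j::int). m = (x \<otimes> x) [^] i \<otimes> z [^] j" by blast
  qed
  consider "x \<in> M" | "x \<notin> M" "y \<in> M" | "x \<notin> M" "x \<otimes> y \<in> M" using M_mult[OF x _ y] by blast
  then show ?thesis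
  proof cases
    case 1
    have yM: "y \<notin> M"
    proof
      assume yM: "y \<in> M"
      obtain i j :: int where "b = x [^] i \<otimes> y [^] j" using gen_y[OF b] by blast
      then show False using b_notin_M Mpow[OF 1] Mpow[OF yM] M.m_closed by metis
    qed
    show ?thesis
    proof (rule bexI[of _ x], rule bexI[of _ "y \<otimes> y"], rule ballI)
      show "y \<otimes> y \<in> M" "x \<in> M" by (rule M_mult[OF y yM y yM], rule 1)
      fix m assume m: "m \<in> M"
      obtain i j :: int where ij: "m = x [^] i \<otimes> y [^] j" using gen_y[OF M.mem_carrier[OF m]] by blast
      have "inv (x [^] i) \<otimes> m \<in> M" using m Mpow[OF 1] by (intro M.m_closed M.m_inv_closed)
      then have "y [^] j \<in> M" using ij x y by simp
      then obtain l :: int where "y [^] j = (y \<otimes> y) [^] l" using pow_in_M[OF y] yM by blast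
      with ij have "m = x [^] i \<otimes> (y \<otimes> y) [^] l" by simp
      then show "\<exists>(i::int) (j::int). m = x [^] i \<otimes> (y \<otimes> y) [^] j" by blast
    qed
  next
    case 2
    show ?thesis by (rule left[OF 2 gen_y])
  next
    case 3
    show ?thesis by (rule left[OF 3 gen_xy])
  qed
qed

text \<open>If \<open>M\<close> were \<open><g>\<close>, then \<open>g^2\<close> would lie in
  \<open>G'\<close>. Both \<open>a\<close> and \<open>b^2\<close> are outside \<open>G'\<close>, so
  they would be odd powers of \<open>g\<close> and their product would fall into \<open>G'\<close>,
  contrary to their independence modulo \<open>G'\<close>.\<close>

lemma M_not_cyclic:
  assumes g: "g \<in> M"
  shows "\<not> M \<subseteq> range (\<lambda>k::int. g [^] k)"
proof
  assume sub: "M \<subseteq> range (\<lambda>k::int. g [^] k)"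
  have gG: "g \<in> carrier G" using g by simp
  have "g \<otimes> g \<in> D" using g unfolding M_def by blast
  have even: "g [^] k \<in> D" if k: "even k" for k :: int
  proof -
    obtain l where "k = 2 * l" using k by (elim evenE)
    then have "g [^] k = (g \<otimes> g) [^] l"
      using int_pow_pow[OF gG, of 2 l] int_pow_mult[OF gG, of 1 1] gG by simp
    then show ?thesis using subgroup_int_pow_closed[OF D.is_subgroup \<open>g \<otimes> g \<in> D\<close>] by simp
  qed
  have "a \<in> range (\<lambda>k::int. g [^] k)" "b \<otimes> b \<in> range (\<lambda>k::int. g [^] k)"
    using sub a_in_M b_sq_in_M by blast+
  then obtain k l :: int where kl: "a = g [^] k" "b \<otimes> b = g [^] l"
    by (elim rangeE) (rule that)
  have bb: "b [^] (2::int) = b \<otimes> b" using int_pow_mult[OF b, of 1 1] by simp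
  have "a \<notin> D" using indep[of 1 0] by simp
  then have "odd k" using kl(1) even by metis
  have "b \<otimes> b \<notin> D" using indep[of 0 2] bb by simp
  then have "odd l" using kl(2) even by metis
  have "a \<otimes> (b \<otimes> b) = g [^] (k + l)" unfolding kl by (simp add: int_pow_mult gG)
  then have "a \<otimes> (b \<otimes> b) \<in> D" using even \<open>odd k\<close> \<open>odd l\<close> by simp
  then show False using indep[of 1 2] bb by simp
qed

lemma min_generators_M_eq_2_iff:
  "min_generators (G\<lparr>carrier := M\<rparr>) = 2 \<longleftrightarrow> (\<exists>u\<in>M. \<exists>v\<in>M. generate G {u, v} = M)"
proof -
  define P where "P k \<longleftrightarrow> (\<exists>S\<subseteq>M. finite S \<and> card S = k \<and> generate G S = M)" for k
  have min: "min_generators (G\<lparr>carrier := M\<rparr>) = (LEAST k. P k)"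
    unfolding min_generators_def P_def
    by (intro arg_cong[where f = Least] ext ex_cong) (auto simp: generate_consistent[OF _ M.is_subgroup])
  have fin: "finite M"
    using ord M.subset by (metis finite_subset order_gt_0_iff_finite pos2 zero_less_power)
  have lower: "2 \<le> k" if "P k" for k
  proof (rule ccontr)
    assume "\<not> 2 \<le> k"
    obtain S where S: "S \<subseteq> M" "finite S" "card S = k" "generate G S = M" using \<open>P k\<close> unfolding P_def by blast
    have "\<exists>g\<in>M. S \<subseteq> {g}"
    proof (cases "S = {}")
      case False
      with S \<open>\<not> 2 \<le> k\<close> have "card S = 1" by (metis Suc_1 Suc_leI card_gt_0_iff le_neq_implies_less not_le One_nat_def)
      then show ?thesis using S(1) by (auto simp: card_1_singleton_iff)
    qed (use M.one_closed in blast)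
    then obtain g where g: "g \<in> M" "S \<subseteq> {g}" by blast
    then have "M \<subseteq> generate G {g}" using mono_generate S(4) by blast
    then show False using M_not_cyclic[OF g(1)] generate_pow[OF M.mem_carrier[OF g(1)]] by auto
  qed
  show ?thesis
  proof
    assume "min_generators (G\<lparr>carrier := M\<rparr>) = 2"
    \<comment> \<open>\<open>M\<close> generates itself, so the minimum is taken over a nonempty set
      and is attained.\<close>
    moreover have "P (card M)"
      using fin generate_subgroup_incl[OF subset_refl M.is_subgroup] generate.incl[of _ M G]
      unfolding P_def by blast
    ultimately have "P 2" using LeastI[of P "card M"] min by simp
    then obtain S where S: "S \<subseteq> M" "card S = 2" "generate G S = M" unfolding P_def by blast
    obtain u v where "S = {u, v}" using S(2) by (auto simp: card_2_iff)
    then show "\<exists>u\<in>M. \<exists>v\<in>M. generate G {u, v} = M" using S by blast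
  next
    assume "\<exists>u\<in>M. \<exists>v\<in>M. generate G {u, v} = M"
    then obtain u v where uv: "u \<in> M" "v \<in> M" "generate G {u, v} = M" by blast
    have "P (card {u, v})"
      unfolding P_def using uv by (intro exI[of _ "{u, v}"] conjI) auto
    \<comment> \<open>With \<open>u = v\<close> the set would have one element, which the lower
      bound excludes.\<close>
    moreover from lower[OF this] have "card {u, v} = 2" by (auto simp: card_insert_if split: if_splits)
    ultimately have "P 2" by simp
    then show "min_generators (G\<lparr>carrier := M\<rparr>) = 2"
      unfolding min using lower by (rule Least_equality)
  qed
qed

text \<open>The alternatives of \<open>M_dichotomy\<close> exclude each other: an abelian group of
  order 8 and exponent 2 is not spanned by two elements, so the elementary type forbids type
  \<open>(2, 2^m)\<close> as well as a generating pair of \<open>M\<close>. A metacyclic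
  \<open>G\<close> supplies such a pair, and the equivalences follow propositionally.\<close>

lemma M_equivalences:
  fixes A :: "'a set monoid"
  assumes A: "A = abelianization (G\<lparr>carrier := M\<rparr>)"
  defines "T \<equiv> \<exists>m\<ge>1. has_abelian_type A [2, 2 ^ m]"
  shows "(has_abelian_type A [2, 2, 2] \<or> T) \<and> (metacyclic G \<longleftrightarrow> T) \<and>
    (T \<longleftrightarrow> min_generators (G\<lparr>carrier := M\<rparr>) = 2)"
proof -
  have gens: "\<exists>u\<in>M. \<exists>v\<in>M. generate G {u, v} = M" if meta: "metacyclic G"
  proof -
    obtain u v where uv: "u \<in> M" "v \<in> M" "\<And>m. m \<in> M \<Longrightarrow> \<exists>(i::int) (j::int). m = u [^] i \<otimes> v [^] j"
      using M_two_generated[OF meta] by blast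
    have sub: "subgroup (generate G {u, v}) G"
      using uv by (intro generate_is_subgroup) auto
    have "generate G {u, v} = M"
    proof
      show "generate G {u, v} \<subseteq> M" using uv(1,2) by (intro generate_subgroup_incl M.is_subgroup) auto
      show "M \<subseteq> generate G {u, v}"
      proof
        fix m assume "m \<in> M"
        from uv(3)[OF this] obtain i j :: int where m: "m = u [^] i \<otimes> v [^] j" by blast
        have "u \<in> generate G {u, v}" "v \<in> generate G {u, v}" by (simp_all add: generate.incl)
        then show "m \<in> generate G {u, v}"
          unfolding m by (intro subgroup.m_closed[OF sub] subgroup_int_pow_closed[OF sub])
      qed
    qed
    then show ?thesis using uv by blast
  qed
  have "\<not> T \<and> \<not> (\<exists>u\<in>M. \<exists>v\<in>M. generate G {u, v} = M)"
    if type: "has_abelian_type A [2, 2, 2]" and sq: "\<forall>x\<in>carrier A. x \<otimes>\<^bsub>A\<^esub> x = \<one>\<^bsub>A\<^esub>"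
  proof -
    interpret A: comm_group A using type by (simp add: has_abelian_type_def)
    have "order A = (\<Prod>i<length [2, 2, 2 :: nat]. [2, 2, 2] ! i)"
      by (rule has_abelian_type_order[OF type]) (auto simp: less_Suc_eq)
    then have "order A = 8" by (simp add: lessThan_Suc)
    then have no_gen: False
      if "u \<in> carrier A" "v \<in> carrier A"
        "\<And>x. x \<in> carrier A \<Longrightarrow> \<exists>(i::int) (j::int). x = u [^]\<^bsub>A\<^esub> i \<otimes>\<^bsub>A\<^esub> v [^]\<^bsub>A\<^esub> j" for u v
      using A.order_le_four[OF that] sq by simp
    have "\<not> T"
    proof
      assume T
      then obtain m where "has_abelian_type A [2, 2 ^ m]" unfolding T_def by blast
      then obtain u v where "u \<in> carrier A" "v \<in> carrier A"
        "\<And>x. x \<in> carrier A \<Longrightarrow> \<exists>(i::int) (j::int). x = u [^]\<^bsub>A\<^esub> i \<otimes>\<^bsub>A\<^esub> v [^]\<^bsub>A\<^esub> j"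
        by (rule has_abelian_type_twoE) auto
      then show False by (rule no_gen)
    qed
    moreover have False if uv: "u \<in> M" "v \<in> M" "generate G {u, v} = M" for u v
    proof -
      obtain A' :: "'a set monoid" and F where A': "A' = abelianization (G\<lparr>carrier := M\<rparr>)"
        and "comm_group A'" and "\<exists>l. order A' = 2 ^ l"
        and F_closed: "\<And>x. x \<in> M \<Longrightarrow> F x \<in> carrier A'"
        and F_mult: "\<And>x y. x \<in> M \<Longrightarrow> y \<in> M \<Longrightarrow> F (x \<otimes> y) = F x \<otimes>\<^bsub>A'\<^esub> F y"
        and F_pow: "\<And>x k. x \<in> M \<Longrightarrow> F (x [^] (k::int)) = F x [^]\<^bsub>A'\<^esub> k"
        and F_eq: "\<And>x y. x \<in> M \<Longrightarrow> y \<in> M \<Longrightarrow> F x = F y \<longleftrightarrow> inv x \<otimes> y \<in> M'"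
        and F_surj: "\<And>z. z \<in> carrier A' \<Longrightarrow> \<exists>x\<in>M. z = F x"
        by (rule obtain_abelianization) (rule that)
      have AA: "A' = A" using A A' by simp
      note F = F_closed[unfolded AA] F_mult[unfolded AA] F_pow[unfolded AA]
      note uvA = F(1)[OF uv(1)] F(1)[OF uv(2)]
      \<comment> \<open>Generation of \<open>M\<close> by \<open>u\<close> and \<open>v\<close>
        passes to the abelian group \<open>A\<close>, where words in the two images collapse to
        ordered products of powers.\<close>
      have span: "\<exists>(i::int) (j::int). F x = F u [^]\<^bsub>A\<^esub> i \<otimes>\<^bsub>A\<^esub> F v [^]\<^bsub>A\<^esub> j"
        if "x \<in> generate G {u, v}" for x
        using that
      proof (induction rule: generate.induct)
        case one
        have "F \<one> = F u [^]\<^bsub>A\<^esub> (0::int) \<otimes>\<^bsub>A\<^esub> F v [^]\<^bsub>A\<^esub> (0::int)"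
          using F(3)[OF uv(1), of 0] by simp
        then show ?case by blast
      next
        case (incl h)
        have "F u = F u [^]\<^bsub>A\<^esub> (1::int) \<otimes>\<^bsub>A\<^esub> F v [^]\<^bsub>A\<^esub> (0::int)"
          "F v = F u [^]\<^bsub>A\<^esub> (0::int) \<otimes>\<^bsub>A\<^esub> F v [^]\<^bsub>A\<^esub> (1::int)" using uvA by simp_all
        with incl show ?case by blast
      next
        case (inv h)
        have "F (inv\<^bsub>G\<^esub> w) = F w [^]\<^bsub>A\<^esub> (- 1 :: int)" if "w \<in> M" for w
          using F(3)[OF that, of "- 1"] that by (simp add: int_pow_neg)
        then have "F (inv u) = F u [^]\<^bsub>A\<^esub> (- 1::int) \<otimes>\<^bsub>A\<^esub> F v [^]\<^bsub>A\<^esub> (0::int)"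
          "F (inv v) = F u [^]\<^bsub>A\<^esub> (0::int) \<otimes>\<^bsub>A\<^esub> F v [^]\<^bsub>A\<^esub> (- 1::int)" using uv uvA by simp_all
        with inv show ?case by blast
      next
        case (eng h1 h2)
        then obtain i j k l :: int where
          ij: "F h1 = F u [^]\<^bsub>A\<^esub> i \<otimes>\<^bsub>A\<^esub> F v [^]\<^bsub>A\<^esub> j" and
          kl: "F h2 = F u [^]\<^bsub>A\<^esub> k \<otimes>\<^bsub>A\<^esub> F v [^]\<^bsub>A\<^esub> l" by blast
        have "h1 \<in> M" "h2 \<in> M" using eng uv(3) by auto
        then have "F (h1 \<otimes> h2) = F u [^]\<^bsub>A\<^esub> (i + k) \<otimes>\<^bsub>A\<^esub> F v [^]\<^bsub>A\<^esub> (j + l)"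
          using F(2) uvA by (simp add: ij kl A.int_pow_mult A.m_ac)
        then show ?case by blast
      qed
      show False
      proof (rule no_gen[OF uvA])
        fix z assume "z \<in> carrier A"
        then obtain x where "x \<in> M" "z = F x" using F_surj AA by blast
        then show "\<exists>(i::int) (j::int). z = F u [^]\<^bsub>A\<^esub> i \<otimes>\<^bsub>A\<^esub> F v [^]\<^bsub>A\<^esub> j"
          using span uv(3) by simp
      qed
    qed
    ultimately show ?thesis by blast
  qed
  then show ?thesis
    using M_dichotomy[OF A] gens min_generators_M_eq_2_iff unfolding T_def by blast
qed

end

section \<open>Identification of the given maximal subgroup\<close>

theorem mainTheorem1:
  fixes G :: "('a, 'b) monoid_scheme" and M :: "'a set"
  assumes "finite_p_group 2 G"
    and "has_abelian_type (abelianization G) [2, 4]"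
    and "maximal_subgroup M G"
    and "derived G (carrier G) \<subseteq> M"
    and "has_abelian_type (G\<lparr>carrier := M\<rparr> Mod derived G (carrier G)) [2, 2]"
  shows "(has_abelian_type (abelianization (G\<lparr>carrier := M\<rparr>)) [2, 2, 2] \<or>
          (\<exists>m\<ge>1. has_abelian_type (abelianization (G\<lparr>carrier := M\<rparr>)) [2, 2 ^ m])) \<and>
         (metacyclic G \<longleftrightarrow>
          (\<exists>m\<ge>1. has_abelian_type (abelianization (G\<lparr>carrier := M\<rparr>)) [2, 2 ^ m])) \<and>
         ((\<exists>m\<ge>1. has_abelian_type (abelianization (G\<lparr>carrier := M\<rparr>)) [2, 2 ^ m]) \<longleftrightarrow>
          min_generators (G\<lparr>carrier := M\<rparr>) = 2)"
proof -
  let ?D = "derived G (carrier G)"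
  interpret group G using assms(1) by (simp add: finite_p_group_def)
  obtain n where n: "order G = 2 ^ n" using assms(1) by (auto simp: finite_p_group_def)
  interpret D: normal ?D G by (rule derived_self_is_normal)
  obtain A :: "'a set monoid" and f where A: "A = abelianization G" and f: "f = (\<lambda>x. ?D #>\<^bsub>G\<^esub> x)"
    by blast
  interpret f: group_hom G A f unfolding A f by (rule D.quotient_hom(1))
  have surj: "f ` carrier G = carrier A" unfolding A f by (rule D.quotient_hom(2))
  have ker: "f x = \<one>\<^bsub>A\<^esub> \<longleftrightarrow> x \<in> ?D" if "x \<in> carrier G" for x
    unfolding A f by (rule D.quotient_hom(3)[OF that])
  obtain u v where uv: "u \<in> carrier A" "v \<in> carrier A"
    "\<And>x. x \<in> carrier A \<Longrightarrow> \<exists>(i::int) (j::int). x = u [^]\<^bsub>A\<^esub> i \<otimes>\<^bsub>A\<^esub> v [^]\<^bsub>A\<^esub> j"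
    "\<And>(i::int) (j::int). u [^]\<^bsub>A\<^esub> i \<otimes>\<^bsub>A\<^esub> v [^]\<^bsub>A\<^esub> j = \<one>\<^bsub>A\<^esub> \<longleftrightarrow> int 2 dvd i \<and> int 4 dvd j"
    by (rule has_abelian_type_twoE[OF assms(2)[folded A]]) auto
  \<comment> \<open>Arbitrary lifts of a basis of \<open>G/G'\<close> satisfy the assumptions of the
    locale.\<close>
  obtain a b where ab: "a \<in> carrier G" "b \<in> carrier G" "u = f a" "v = f b"
    using uv(1,2) unfolding surj[symmetric] by blast
  interpret two_four_group G a b n
  proof
    show "order G = 2 ^ n" "a \<in> carrier G" "b \<in> carrier G" by fact+
    show "\<exists>(i::int) (j::int). \<exists>d\<in>?D. x = a [^]\<^bsub>G\<^esub> i \<otimes>\<^bsub>G\<^esub> b [^]\<^bsub>G\<^esub> j \<otimes>\<^bsub>G\<^esub> d" if x: "x \<in> carrier G" for x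
    proof -
      obtain i j :: int where ij: "f x = u [^]\<^bsub>A\<^esub> i \<otimes>\<^bsub>A\<^esub> v [^]\<^bsub>A\<^esub> j" using uv(3)[OF f.hom_closed[OF x]] by blast
      define g where "g = a [^]\<^bsub>G\<^esub> i \<otimes>\<^bsub>G\<^esub> b [^]\<^bsub>G\<^esub> j"
      have g: "g \<in> carrier G" "f g = f x" using ab by (simp_all add: g_def ij f.hom_int_pow)
      have "f (inv\<^bsub>G\<^esub> g \<otimes>\<^bsub>G\<^esub> x) = \<one>\<^bsub>A\<^esub>" using g x by simp
      then have "inv\<^bsub>G\<^esub> g \<otimes>\<^bsub>G\<^esub> x \<in> ?D" using ker[of "inv\<^bsub>G\<^esub> g \<otimes>\<^bsub>G\<^esub> x"] g x by simp
      moreover have "x = g \<otimes>\<^bsub>G\<^esub> (inv\<^bsub>G\<^esub> g \<otimes>\<^bsub>G\<^esub> x)" using g x by simp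
      ultimately show ?thesis unfolding g_def by blast
    qed
    show "a [^]\<^bsub>G\<^esub> i \<otimes>\<^bsub>G\<^esub> b [^]\<^bsub>G\<^esub> j \<in> ?D \<longleftrightarrow> even i \<and> 4 dvd j" for i j :: int
      using uv(4)[of i j] ker[of "a [^]\<^bsub>G\<^esub> i \<otimes>\<^bsub>G\<^esub> b [^]\<^bsub>G\<^esub> j"] ab by (simp add: f.hom_int_pow)
  qed
  let ?M = "two_four_group.M G"
  have M: "subgroup M G" "M \<noteq> carrier G" "\<And>H. subgroup H G \<Longrightarrow> M \<subseteq> H \<Longrightarrow> H = M \<or> H = carrier G"
    using assms(3) unfolding maximal_subgroup_def by blast+
  \<comment> \<open>A quotient \<open>M/G'\<close> of type \<open>(2, 2)\<close> has exponent 2, so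
    squares of elements of \<open>M\<close> lie in \<open>G'\<close>. Since \<open>b\<close> is
    outside \<open>?M\<close>, maximality of \<open>M\<close> turns this inclusion into
    equality.\<close>
  have "M \<subseteq> ?M"
  proof
    fix x assume x: "x \<in> M"
    have xG: "x \<in> carrier G" using x subgroup.subset[OF M(1)] by blast
    define H where "H = G\<lparr>carrier := M\<rparr>"
    interpret N: normal ?D H
      unfolding H_def by (rule normal_restrict_supergroup[OF M(1) D.normal_axioms assms(4)])
    obtain B :: "'a set monoid" and h where B: "B = H Mod ?D" and h: "h = (\<lambda>x. ?D #>\<^bsub>H\<^esub> x)"
      by blast
    interpret h: group_hom H B h unfolding B h by (rule N.quotient_hom(1))
    have xH: "x \<in> carrier H" using x by (simp add: H_def)
    have type: "has_abelian_type B [2, 2]" using assms(5) by (simp add: B H_def)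
    interpret B: comm_group B using type by (simp add: has_abelian_type_def)
    obtain p q where pq: "p \<in> carrier B" "q \<in> carrier B"
      "\<And>x. x \<in> carrier B \<Longrightarrow> \<exists>(i::int) (j::int). x = p [^]\<^bsub>B\<^esub> i \<otimes>\<^bsub>B\<^esub> q [^]\<^bsub>B\<^esub> j"
      "\<And>(i::int) (j::int). p [^]\<^bsub>B\<^esub> i \<otimes>\<^bsub>B\<^esub> q [^]\<^bsub>B\<^esub> j = \<one>\<^bsub>B\<^esub> \<longleftrightarrow> int 2 dvd i \<and> int 2 dvd j"
      by (rule has_abelian_type_twoE[OF type]) auto
    obtain i j :: int where "h x = p [^]\<^bsub>B\<^esub> i \<otimes>\<^bsub>B\<^esub> q [^]\<^bsub>B\<^esub> j" using pq(3)[OF h.hom_closed[OF xH]] by blast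
    then have "h (x \<otimes>\<^bsub>H\<^esub> x) = p [^]\<^bsub>B\<^esub> (i + i) \<otimes>\<^bsub>B\<^esub> q [^]\<^bsub>B\<^esub> (j + j)"
      using pq(1,2) xH by (simp only: h.hom_mult h.H.int_pow_mult) (simp add: B.m_ac)
    also have "\<dots> = \<one>\<^bsub>B\<^esub>" unfolding pq(4) by simp
    finally have "x \<otimes>\<^bsub>H\<^esub> x \<in> ?D"
      using N.quotient_hom(3)[of "x \<otimes>\<^bsub>H\<^esub> x"] xH unfolding B h by blast
    then show "x \<in> ?M" using xG unfolding M_def by (simp add: H_def)
  qed
  then have eq: "?M = M" using M(3)[OF normal_imp_subgroup[OF M_normal]] b_notin_M ab(2) by blast
  from M_equivalences[OF refl] show ?thesis unfolding eq .
qed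

end
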